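(* Let $u$ be a (classical) solution in $\mathbb{R}^2$ of $$\Delta u=0\ \text{ in } \Omega:=\{-1<u<1\},\qquad u=\pm1\ \text{ outside }\Omega,\qquad |\nabla u|=1\ \text{ on }\partial\Omega .$$ If $\Omega$ is not connected, then $u$ is one dimensional.
   Context: A solution is always understood as a classical solution: $\Omega=\{-1<u<1\}$ is an open set in $\mathbb{R}^2$ with smooth boundary, $u\in C(\mathbb{R}^2)\cap C^2(\overline\Omega)$, and the equation and the boundary conditions hold pointwise (on $\partial\Omega$ the gradient is taken from inside $\Omega$). "One dimensional" means that there is a unit vector $e$ such that $u$ depends only on $x\cdot e$. No stability condition is assumed. *)

theory Defs
  imports "HOL-Analysis.Analysis"
begin

definition partial_deriv :: "'a::euclidean_space \<Rightarrow> ('a \<Rightarrow> real) \<Rightarrow> 'a \<Rightarrow> real"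
  where "partial_deriv i f x = frechet_derivative f (at x) i"

definition grad :: "('a::euclidean_space \<Rightarrow> real) \<Rightarrow> 'a \<Rightarrow> 'a"
  where "grad f x = (\<Sum>i\<in>Basis. partial_deriv i f x *\<^sub>R i)"

definition laplacian :: "('a::euclidean_space \<Rightarrow> real) \<Rightarrow> 'a \<Rightarrow> real"
  where "laplacian f x = (\<Sum>i\<in>Basis. partial_deriv i (partial_deriv i f) x)"

text \<open>
  For an open set \<open>S\<close>: \<open>f\<close> is twice differentiable in \<open>S\<close>, and \<open>f\<close> and its partial derivatives of
  order one and two extend continuously from \<open>S\<close> to the closure of \<open>S\<close> (\<open>f\<close> being its own
  extension). In particular they are continuous in \<open>S\<close>.
\<close>

definition C2_on_closure :: "'a::euclidean_space set \<Rightarrow> ('a \<Rightarrow> real) \<Rightarrow> bool"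
  where "C2_on_closure S f \<longleftrightarrow>
    continuous_on (closure S) f \<and>
    (\<forall>x\<in>S. f differentiable at x) \<and>
    (\<forall>i\<in>Basis. \<forall>x\<in>S. partial_deriv i f differentiable at x) \<and>
    (\<forall>i\<in>Basis. \<exists>g. continuous_on (closure S) g \<and> (\<forall>x\<in>S. g x = partial_deriv i f x)) \<and>
    (\<forall>i\<in>Basis. \<forall>j\<in>Basis. \<exists>g. continuous_on (closure S) g \<and>
       (\<forall>x\<in>S. g x = partial_deriv j (partial_deriv i f) x))"

text \<open>
  The gradient at a boundary point of the open set \<open>S\<close>, taken from inside \<open>S\<close>. If \<open>f\<close> satisfies
  \<open>C2_on_closure S f\<close>, then the limit exists at every point of the frontier of \<open>S\<close>.
\<close>

definition boundary_grad :: "'a::euclidean_space set \<Rightarrow> ('a \<Rightarrow> real) \<Rightarrow> 'a \<Rightarrow> 'a"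
  where "boundary_grad S f x = Lim (at x within S) (grad f)"

definition smooth_real_fun :: "(real \<Rightarrow> real) \<Rightarrow> bool"
  where "smooth_real_fun \<gamma> \<longleftrightarrow> (\<forall>k t. (deriv ^^ k) \<gamma> differentiable at t)"

text \<open>
  Near each boundary point, \<open>S\<close> is, in suitable orthonormal coordinates, the part of the plane
  strictly above the graph of a smooth function. In particular \<open>S\<close> lies locally on one side of
  its boundary.
\<close>

definition smooth_boundary :: "(real^2) set \<Rightarrow> bool"
  where "smooth_boundary S \<longleftrightarrow>
    (\<forall>p\<in>frontier S. \<exists>r>0. \<exists>\<tau> \<nu> \<gamma>.
       norm \<tau> = 1 \<and> norm \<nu> = 1 \<and> \<tau> \<bullet> \<nu> = 0 \<and> smooth_real_fun \<gamma> \<and>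
       S \<inter> ball p r = {x \<in> ball p r. \<gamma> (x \<bullet> \<tau>) < x \<bullet> \<nu>})"

definition middle_phase :: "(real^2 \<Rightarrow> real) \<Rightarrow> (real^2) set"
  where "middle_phase u = {x. -1 < u x \<and> u x < 1}"

definition classical_solution :: "(real^2 \<Rightarrow> real) \<Rightarrow> bool"
  where "classical_solution u \<longleftrightarrow>
    (let \<Omega> = middle_phase u in
       open \<Omega> \<and> smooth_boundary \<Omega> \<and>
       continuous_on UNIV u \<and> C2_on_closure \<Omega> u \<and>
       (\<forall>x\<in>\<Omega>. laplacian u x = 0) \<and>
       (\<forall>x. x \<notin> \<Omega> \<longrightarrow> u x = 1 \<or> u x = -1) \<and>
       (\<forall>x\<in>frontier \<Omega>. norm (boundary_grad \<Omega> u x) = 1))"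

definition one_dimensional :: "('a::real_inner \<Rightarrow> 'b) \<Rightarrow> bool"
  where "one_dimensional u \<longleftrightarrow> (\<exists>e. norm e = 1 \<and> (\<exists>g. \<forall>x. u x = g (x \<bullet> e)))"

end

theory Submission
  imports Defs "HOL-Complex_Analysis.Complex_Analysis"
begin

text \<open>
  Why the theorem holds. Write \<open>S\<close> for the open set \<open>{-1 < u < 1}\<close>. On \<open>S\<close> the function
  \<open>f = u\<^sub>x - i u\<^sub>y\<close> is holomorphic, and \<open>\<bar>f\<bar> = 1\<close> on the boundary of \<open>S\<close>. Harnack's inequality on the
  largest disc in \<open>S\<close> around a point, compared with the unit slope at the boundary point that the
  disc touches, bounds \<open>\<bar>f\<bar>\<close> by an absolute constant (\<open>grad_le_4\<close>). Since \<open>S\<close> omits a disc, a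
  Phragmen-Lindelof argument improves this to \<open>\<bar>f\<bar> \<le> 1\<close> (\<open>grad_le_1\<close>), so \<open>u\<close> is 1-Lipschitz on the
  whole plane (\<open>lipschitz\<close>).

  The gradient bound forces the complement of \<open>S\<close> to be locally convex: otherwise \<open>S\<close> lies, near
  some boundary point, above a parabola that touches the boundary there, and an explicit quadratic
  barrier makes the normal derivative of \<open>u\<close> at that point smaller than \<open>1\<close>
  (\<open>no_touching_parabola\<close>). A closed connected locally convex set is convex (\<open>Tietze_Nakajima\<close>),
  hence every component of the complement is convex.

  If \<open>S\<close> is disconnected, then already one component of its complement separates the plane, and a
  closed convex set that separates the plane contains a line (\<open>convex_separator_contains_line\<close>).
  Start from this line. A component that contains a line is a slab between two parallel lines or a
  half-plane. Beyond an edge of it \<open>u\<close> is the linear function with the same boundary data: the difference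
  has a sign because \<open>u\<close> is 1-Lipschitz, and its normal derivative at the edge vanishes, so Harnack's
  inequality makes it zero (\<open>linear_beyond_flat_boundary\<close>). After distance \<open>2\<close> the linear function
  reaches the opposite value on a parallel line outside \<open>S\<close>, and the argument starts again from
  that line. Iterating in both directions covers the plane.
\<close>

section \<open>Connected locally convex sets are convex\<close>

text \<open>
  The doubling step behind the convexity theorem: if broken lines with two legs of length at most
  \<open>L\<close> can be straightened inside \<open>C\<close>, then so can those with legs of length at most \<open>2 L\<close>. Given a
  broken line \<open>x, y, z\<close>, cut off its corner at the midpoints of the legs, straighten, and take
  the midpoint of the cut as the new corner. The distance of the corner from the midpoint of \<open>x\<close>
  and \<open>z\<close> is halved, so in the limit the broken line becomes the segment.
\<close>

lemma broken_line_doubling: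
  fixes C B :: "'a::euclidean_space set"
  assumes C: "closed C" and B: "convex B"
    and short: "\<And>x y z. \<lbrakk>x \<in> B; y \<in> B; z \<in> B; closed_segment x y \<subseteq> C; closed_segment y z \<subseteq> C;
                   dist x y \<le> L; dist y z \<le> L\<rbrakk> \<Longrightarrow> closed_segment x z \<subseteq> C"
    and xyz: "x \<in> B" "y \<in> B" "z \<in> B" "closed_segment x y \<subseteq> C" "closed_segment y z \<subseteq> C"
             "dist x y \<le> 2 * L" "dist y z \<le> 2 * L"
  shows "closed_segment x z \<subseteq> C"
proof -
  define m where "m = midpoint x z"
  \<comment> \<open>the successive corners of the broken line\<close>
  define p where "p n = m + (1/2)^n *\<^sub>R (y - m)" for n :: nat
  have mid_in: "midpoint a b \<in> B" if "a \<in> B" "b \<in> B" for a b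
    using closed_segment_subset[OF that B] midpoint_in_closed_segment[of a b] by blast
  have "dist x z \<le> 4 * L"
    using dist_triangle[of x z y] xyz(6,7) by linarith
  then have m: "m \<in> B" "dist x m \<le> 2 * L" "dist z m \<le> 2 * L"
    unfolding m_def using mid_in[OF xyz(1,3)] by (simp_all add: dist_midpoint)
  have p_seg: "p n \<in> closed_segment m y" for n
    unfolding p_def closed_segment_def
    by (auto simp: algebra_simps power_le_one intro!: exI[of _ "(1/2)^n"])
  have sub: "closed_segment m y \<subseteq> S" if "convex S" "m \<in> S" "y \<in> S" for S
    using that by (simp add: closed_segment_subset)
  have pB: "p n \<in> B" for n
    using p_seg sub[OF B m(1) xyz(2)] by blast
  have px: "dist x (p n) \<le> 2 * L" for n
    using p_seg sub[of "cball x (2*L)"] m xyz by force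
  have pz: "dist (p n) z \<le> 2 * L" for n
    using p_seg[of n] sub[of "cball z (2*L)"] m xyz by (force simp: dist_commute)
  have p_Suc: "p (Suc n) = midpoint (midpoint x (p n)) (midpoint (p n) z)" for n
    unfolding p_def m_def midpoint_def by (simp add: algebra_simps flip: scaleR_add_left)
  have segs: "closed_segment x (p n) \<subseteq> C \<and> closed_segment (p n) z \<subseteq> C" for n
  proof (induction n)
    case 0
    then show ?case using xyz by (simp add: p_def)
  next
    case (Suc n)
    define m1 m2 where "m1 = midpoint x (p n)" and "m2 = midpoint (p n) z"
    have q: "p (Suc n) = midpoint m1 m2" unfolding m1_def m2_def by (rule p_Suc)
    have inB: "m1 \<in> B" "m2 \<in> B" "p (Suc n) \<in> B"
      unfolding m1_def m2_def using mid_in xyz pB by auto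
    have d: "dist x m1 \<le> L" "dist m1 (p n) \<le> L" "dist (p n) m2 \<le> L" "dist m2 z \<le> L"
      using px[of n] pz[of n] by (auto simp: m1_def m2_def dist_midpoint dist_commute)
    have s1: "closed_segment x m1 \<subseteq> C" "closed_segment m1 (p n) \<subseteq> C"
      using Suc.IH unfolding m1_def by (meson convex_closed_segment closed_segment_subset
        ends_in_segment midpoint_in_closed_segment order_trans)+
    have s2: "closed_segment (p n) m2 \<subseteq> C" "closed_segment m2 z \<subseteq> C"
      using Suc.IH unfolding m2_def by (meson convex_closed_segment closed_segment_subset
        ends_in_segment midpoint_in_closed_segment order_trans)+
    have s: "closed_segment m1 m2 \<subseteq> C"
      by (rule short[OF inB(1) pB inB(2) s1(2) s2(1) d(2,3)])
    have s3: "closed_segment m1 (p (Suc n)) \<subseteq> C" "closed_segment (p (Suc n)) m2 \<subseteq> C"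
      using s unfolding q by (meson convex_closed_segment closed_segment_subset
        ends_in_segment midpoint_in_closed_segment order_trans)+
    have d3: "dist m1 (p (Suc n)) \<le> L" "dist (p (Suc n)) m2 \<le> L"
      using d(2,3) dist_triangle[of m1 m2 "p n"] unfolding q by (auto simp: dist_midpoint)
    show ?case
      using short[OF xyz(1) inB(1) inB(3) s1(1) s3(1) d(1) d3(1)]
            short[OF inB(3) inB(2) xyz(3) s3(2) s2(2) d3(2) d(4)] by blast
  qed
  have p_lim: "p \<longlonglongrightarrow> m"
  proof -
    have "(\<lambda>n. m + (1/2)^n *\<^sub>R (y - m)) \<longlonglongrightarrow> m + 0 *\<^sub>R (y - m)"
      by (intro tendsto_intros LIMSEQ_power_zero) auto
    then show ?thesis by (simp add: p_def[abs_def])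
  qed
  have half: "closed_segment w m \<subseteq> C" if "\<And>n. closed_segment w (p n) \<subseteq> C" for w
  proof
    fix v assume "v \<in> closed_segment w m"
    then obtain s where s: "0 \<le> s" "s \<le> 1" "v = (1 - s) *\<^sub>R w + s *\<^sub>R m"
      by (auto simp: closed_segment_def)
    have lim: "(\<lambda>n. (1 - s) *\<^sub>R w + s *\<^sub>R p n) \<longlonglongrightarrow> v"
      unfolding s(3) by (intro tendsto_intros p_lim)
    have "(1 - s) *\<^sub>R w + s *\<^sub>R p n \<in> closed_segment w (p n)" for n
      unfolding in_segment using s(1,2) by blast
    then have "(1 - s) *\<^sub>R w + s *\<^sub>R p n \<in> C" for n
      using that by blast
    then show "v \<in> C"
      using closed_sequentially[OF C _ lim] by simp
  qed
  have "closed_segment x m \<subseteq> C" "closed_segment z m \<subseteq> C"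
    using half[of x] half[of z] segs by (simp_all add: closed_segment_commute)
  moreover have "closed_segment x z = closed_segment x m \<union> closed_segment m z"
    unfolding m_def by (simp add: Un_closed_segment)
  ultimately show ?thesis by (simp add: closed_segment_commute)
qed

text \<open>
  On a bounded region a Lebesgue number gives a uniform scale on which \<open>C\<close> is convex; doubling
  this scale finitely often reaches the lengths of the given legs.
\<close>

lemma locally_convex_triangle:
  fixes C :: "'a::euclidean_space set"
  assumes C: "closed C" and loc: "\<And>p. p \<in> C \<Longrightarrow> \<exists>r>0. convex (C \<inter> ball p r)"
    and xyz: "closed_segment x y \<subseteq> C" "closed_segment y z \<subseteq> C"
  shows "closed_segment x z \<subseteq> C"
proof -
  define B where "B = cball y (dist x y + dist y z)"
  have inB: "x \<in> B" "y \<in> B" "z \<in> B" and B: "convex B"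
    by (auto simp: B_def dist_commute)
  obtain r where r: "\<And>p. p \<in> C \<Longrightarrow> r p > 0 \<and> convex (C \<inter> ball p (r p))"
    using loc by metis
  obtain \<epsilon> where \<epsilon>: "\<epsilon> > 0" "\<And>p. p \<in> C \<inter> B \<Longrightarrow> \<exists>G\<in>(\<lambda>p. ball p (r p)) ` C. ball p \<epsilon> \<subseteq> G"
  proof (rule Heine_Borel_lemma[of "C \<inter> B" "(\<lambda>p. ball p (r p)) ` C"])
    show "compact (C \<inter> B)" using C by (simp add: B_def closed_Int_compact)
    show "C \<inter> B \<subseteq> \<Union> ((\<lambda>p. ball p (r p)) ` C)" using r by force
  qed auto
  have Q: "closed_segment a c \<subseteq> C"
    if "a \<in> B" "b \<in> B" "c \<in> B" "closed_segment a b \<subseteq> C" "closed_segment b c \<subseteq> C"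
       "dist a b \<le> 2^n * (\<epsilon>/2)" "dist b c \<le> 2^n * (\<epsilon>/2)" for n a b c
    using that
  proof (induction n arbitrary: a b c)
    case 0
    have abc: "a \<in> C" "b \<in> C" "c \<in> C" using 0 by auto
    obtain p where p: "p \<in> C" "ball b \<epsilon> \<subseteq> ball p (r p)"
      using \<epsilon>(2)[of b] abc 0 by auto
    have "a \<in> ball b \<epsilon>" "c \<in> ball b \<epsilon>" using 0 \<epsilon>(1) by (auto simp: dist_commute)
    then have "a \<in> C \<inter> ball p (r p)" "c \<in> C \<inter> ball p (r p)" using p(2) abc by auto
    then have "closed_segment a c \<subseteq> C \<inter> ball p (r p)"
      using r[OF p(1)] by (meson closed_segment_subset)
    then show ?case by blast
  next
    case (Suc n)
    have d: "dist a b \<le> 2 * (2^n * (\<epsilon>/2))" "dist b c \<le> 2 * (2^n * (\<epsilon>/2))"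
      using Suc.prems(6,7) by simp_all
    show ?case
      by (rule broken_line_doubling[OF C B Suc.IH Suc.prems(1-5) d])
  qed
  obtain n where n: "(dist x y + dist y z) / (\<epsilon>/2) < 2^n"
    using real_arch_pow[of 2] by auto
  have "dist x y + dist y z \<le> 2^n * (\<epsilon>/2)"
    using n \<epsilon>(1) by (simp add: field_simps)
  then have "dist x y \<le> 2^n * (\<epsilon>/2)" "dist y z \<le> 2^n * (\<epsilon>/2)"
    using zero_le_dist[of x y] zero_le_dist[of y z] by linarith+
  then show ?thesis using Q[OF inB xyz] by blast
qed

text \<open>
  Being joined by a segment inside \<open>C\<close> is an open relation by local convexity and transitive by
  the preceding lemma, so on a connected set it holds between any two points.
\<close>

theorem Tietze_Nakajima:
  fixes C :: "'a::euclidean_space set"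
  assumes C: "closed C" "connected C" and loc: "\<And>p. p \<in> C \<Longrightarrow> \<exists>r>0. convex (C \<inter> ball p r)"
  shows "convex C"
proof -
  have "closed_segment a b \<subseteq> C" if "a \<in> C" "b \<in> C" for a b
  proof (rule connected_equivalence_relation[OF C(2) that])
    fix p assume p: "p \<in> C"
    obtain r where r: "r > 0" "convex (C \<inter> ball p r)" using loc[OF p] by blast
    have "closed_segment p x \<subseteq> C" if "x \<in> C \<inter> ball p r" for x
      using closed_segment_subset[OF _ that r(2), of p] p r(1) by auto
    then show "\<exists>T. openin (top_of_set C) T \<and> p \<in> T \<and> (\<forall>x\<in>T. closed_segment p x \<subseteq> C)"
      by (intro exI[of _ "C \<inter> ball p r"]) (use p r in auto)
  qed (use locally_convex_triangle[OF C(1) loc] in \<open>auto simp: closed_segment_commute\<close>)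
  then show ?thesis by (simp add: convex_contains_segment)
qed

section \<open>Convex sets that separate the plane\<close>

definition perp :: "real^2 \<Rightarrow> real^2"
  where "perp x = vector [- (x$2), x$1]"

lemma norm_perp [simp]: "norm (perp e) = norm e"
  by (simp add: perp_def norm_vec_def L2_set_def sum_2 add.commute)

lemma inner_perp [simp]: "e \<bullet> perp e = 0" "perp e \<bullet> e = 0"
  by (simp_all add: perp_def inner_vec_def sum_2)

lemma orthonormal_decomp:
  fixes x :: "real^2"
  assumes "norm \<tau> = 1" "norm \<nu> = 1" "\<tau> \<bullet> \<nu> = 0"
  shows "(x \<bullet> \<tau>) *\<^sub>R \<tau> + (x \<bullet> \<nu>) *\<^sub>R \<nu> = x"
proof -
  have 1: "\<tau>$1 * \<tau>$1 + \<tau>$2 * \<tau>$2 = 1" "\<nu>$1 * \<nu>$1 + \<nu>$2 * \<nu>$2 = 1" "\<tau>$1 * \<nu>$1 + \<tau>$2 * \<nu>$2 = 0"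
    using assms by (simp_all add: norm_eq_1 inner_vec_def sum_2)
  have "\<nu>$2 * \<nu>$2 = \<tau>$1 * \<tau>$1" "\<nu>$1 * \<nu>$1 = \<tau>$2 * \<tau>$2" "\<tau>$1 * \<tau>$2 + \<nu>$1 * \<nu>$2 = 0"
    using 1 by algebra+
  then show ?thesis
    using 1 by (simp add: vec_eq_iff forall_2 inner_vec_def sum_2) algebra
qed

lemma orthonormal_norm:
  fixes x :: "real^2"
  assumes "norm \<tau> = 1" "norm \<nu> = 1" "\<tau> \<bullet> \<nu> = 0"
  shows "(norm x)\<^sup>2 = (x \<bullet> \<tau>)\<^sup>2 + (x \<bullet> \<nu>)\<^sup>2"
proof -
  have "(norm x)\<^sup>2 = x \<bullet> ((x \<bullet> \<tau>) *\<^sub>R \<tau> + (x \<bullet> \<nu>) *\<^sub>R \<nu>)"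
    unfolding orthonormal_decomp[OF assms] by (simp add: power2_norm_eq_inner)
  then show ?thesis by (simp add: inner_add_right power2_eq_square)
qed

lemma separating_halfplane:
  fixes C :: "'a::euclidean_space set"
  assumes "closed C" "convex C" "C \<noteq> {}" "z \<notin> C"
  obtains e \<alpha> where "norm e = 1" "z \<bullet> e < \<alpha>" "\<And>x. x \<in> C \<Longrightarrow> x \<bullet> e > \<alpha>"
proof -
  obtain f b where f: "f \<bullet> z < b" "\<And>x. x \<in> C \<Longrightarrow> f \<bullet> x > b"
    using separating_hyperplane_closed_point[OF assms(2,1,4)] by blast
  have "f \<noteq> 0" using f assms(3) by force
  then show ?thesis
    using f by (intro that[of "f /\<^sub>R norm f" "b / norm f"])
               (auto simp: inner_commute field_simps)
qed

text \<open>
  Points of \<open>C\<close> far away in direction \<open>\<tau>\<close> within a strip along \<open>\<tau>\<close> are seen from \<open>c\<close> in directions that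
  converge to \<open>\<tau>\<close>, so the segments from \<open>c\<close> to them converge to the ray.
\<close>

lemma convex_contains_ray:
  fixes C :: "(real^2) set"
  assumes C: "closed C" "convex C" and c: "c \<in> C"
    and o: "norm \<tau> = 1" "norm e = 1" "\<tau> \<bullet> e = 0"
    and K: "\<And>x. x \<in> C \<Longrightarrow> \<bar>x \<bullet> e\<bar> \<le> K"
    and unb: "\<And>M. \<exists>x\<in>C. x \<bullet> \<tau> > M" and t: "t \<ge> 0"
  shows "c + t *\<^sub>R \<tau> \<in> C"
proof -
  have "\<exists>x\<in>C. x \<bullet> \<tau> > c \<bullet> \<tau> + t + real (Suc n)" for n
    by (rule unb)
  then obtain x where x: "\<And>n. x n \<in> C" "\<And>n. x n \<bullet> \<tau> > c \<bullet> \<tau> + t + real (Suc n)"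
    by metis
  define s where "s n = t / ((x n - c) \<bullet> \<tau>)" for n
  have den: "(x n - c) \<bullet> \<tau> > t + real (Suc n)" for n
    using x(2)[of n] by (simp add: inner_diff_left)
  have s: "0 \<le> s n" "s n \<le> 1" "s n \<le> t / real (Suc n)" for n
  proof -
    have "0 < (x n - c) \<bullet> \<tau>" "t \<le> (x n - c) \<bullet> \<tau>" "real (Suc n) \<le> (x n - c) \<bullet> \<tau>"
      using den[of n] t by auto
    then show "0 \<le> s n" "s n \<le> 1" "s n \<le> t / real (Suc n)"
      unfolding s_def using t by (auto intro!: divide_left_mono)
  qed
  define y where "y n = c + s n *\<^sub>R (x n - c)" for n
  have yC: "y n \<in> C" for n
  proof -
    have "y n = (1 - s n) *\<^sub>R c + s n *\<^sub>R x n" by (simp add: y_def algebra_simps)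
    then show ?thesis using convexD_alt[OF C(2) c x(1) s(1,2)] by simp
  qed
  have y_eq: "y n - (c + t *\<^sub>R \<tau>) = (s n * ((x n - c) \<bullet> e)) *\<^sub>R e" for n
  proof -
    have "s n *\<^sub>R (x n - c) = s n *\<^sub>R ((((x n - c) \<bullet> \<tau>) *\<^sub>R \<tau>) + (((x n - c) \<bullet> e) *\<^sub>R e))"
      using orthonormal_decomp[OF o, of "x n - c"] by simp
    also have "\<dots> = t *\<^sub>R \<tau> + (s n * ((x n - c) \<bullet> e)) *\<^sub>R e"
      using den[of n] t by (simp add: s_def scaleR_add_right)
    finally show ?thesis by (simp add: y_def)
  qed
  have "\<bar>(x n - c) \<bullet> e\<bar> \<le> 2 * K" for n
    using K[OF x(1)[of n]] K[OF c] by (simp add: inner_diff_left)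
  then have le: "norm (y n - (c + t *\<^sub>R \<tau>)) \<le> t / real (Suc n) * (2 * K)" for n
    using mult_mono[OF s(3)[of n], of "\<bar>(x n - c) \<bullet> e\<bar>" "2 * K"] t s(1)[of n] o(2)
    unfolding y_eq by (simp add: abs_mult)
  have z: "(\<lambda>n. t / real (Suc n) * (2 * K)) \<longlonglongrightarrow> 0"
    by real_asymp
  have "(\<lambda>n. y n - (c + t *\<^sub>R \<tau>)) \<longlonglongrightarrow> 0"
    by (rule Lim_null_comparison[OF always_eventually[OF allI[OF le]] z])
  then have lim: "y \<longlonglongrightarrow> c + t *\<^sub>R \<tau>"
    by (simp add: LIM_zero_iff)
  show ?thesis using closed_sequentially[OF C(1) _ lim] yC by blast
qed

text \<open>
  Two points in different components of the complement are cut off from \<open>C\<close> by open half-planes.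
  These must be disjoint, since otherwise they would connect the points; hence they are opposite
  and \<open>C\<close> lies in a strip. If \<open>C\<close> ended in one direction of the strip, a third half-plane across the
  end would connect the first two. So \<open>C\<close> contains both rays from each of its points.
\<close>

lemma convex_separator_contains_line:
  fixes C :: "(real^2) set"
  assumes C: "closed C" "convex C" and sep: "\<not> connected (- C)"
  obtains e a where "norm e = 1" "{x. x \<bullet> e = a} \<subseteq> C"
proof -
  have ne: "C \<noteq> {}" using sep by auto
  obtain a b where ab: "a \<notin> C" "b \<notin> C" "\<not> connected_component (- C) a b"
    using sep by (auto simp: connected_iff_connected_component)
  obtain e \<alpha> where e: "norm e = 1" "a \<bullet> e < \<alpha>" "\<And>x. x \<in> C \<Longrightarrow> x \<bullet> e > \<alpha>"
    using separating_halfplane[OF C ne ab(1)] by metis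
  obtain f \<beta> where f: "norm f = 1" "b \<bullet> f < \<beta>" "\<And>x. x \<in> C \<Longrightarrow> x \<bullet> f > \<beta>"
    using separating_halfplane[OF C ne ab(2)] by metis
  have conn: "connected {x. x \<bullet> g < c}" for g :: "real^2" and c
    using convex_halfspace_lt[of g c] by (intro convex_connected) (simp add: inner_commute)
  have cc: "connected_component (- C) p q" if "p \<bullet> g < c" "q \<bullet> g < c" "\<And>x. x \<in> C \<Longrightarrow> x \<bullet> g \<ge> c" for p q g c
    unfolding connected_component_def using that conn[of g c] by (intro exI[of _ "{x. x \<bullet> g < c}"]) force
  have disj: "\<not> (x \<bullet> e < \<alpha> \<and> x \<bullet> f < \<beta>)" for x
  proof
    assume "x \<bullet> e < \<alpha> \<and> x \<bullet> f < \<beta>"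
    then have "connected_component (- C) a x" "connected_component (- C) b x"
      using cc[of a e \<alpha> x] cc[of b f \<beta> x] e f by (auto intro: less_imp_le)
    then show False using ab(3) connected_component_sym connected_component_trans by blast
  qed
  define \<tau> where "\<tau> = perp e"
  have o: "norm \<tau> = 1" "norm e = 1" "\<tau> \<bullet> e = 0" by (simp_all add: \<tau>_def e(1))
  have ft: "f \<bullet> \<tau> = 0"
  proof (rule ccontr)
    assume n: "f \<bullet> \<tau> \<noteq> 0"
    define x where "x = a + ((\<beta> - 1 - a \<bullet> f) / (f \<bullet> \<tau>)) *\<^sub>R \<tau>"
    have "x \<bullet> e = a \<bullet> e" "x \<bullet> f = \<beta> - 1"
      using o n by (simp_all add: x_def inner_add_left inner_commute[of \<tau> f])
    then show False using disj[of x] e(2) by simp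
  qed
  have fe: "f = (f \<bullet> e) *\<^sub>R e"
    using orthonormal_decomp[OF o, of f] ft by simp
  have neg: "f \<bullet> e < 0"
  proof (rule ccontr)
    assume "\<not> f \<bullet> e < 0"
    moreover have "f \<bullet> e \<noteq> 0" using fe f(1) by force
    ultimately have p: "f \<bullet> e > 0" by simp
    define m where "m = min (\<alpha> - 1) ((\<beta> - 1) / (f \<bullet> e))"
    have ee: "e \<bullet> e = 1" using e(1) by (simp add: norm_eq_1)
    have "(m *\<^sub>R e) \<bullet> e < \<alpha>" by (simp add: ee m_def)
    moreover have "(m *\<^sub>R e) \<bullet> f \<le> \<beta> - 1"
      using p by (simp add: inner_commute[of e f] m_def min_def field_simps)
    ultimately show False using disj[of "m *\<^sub>R e"] by auto
  qed
  have up: "x \<bullet> e < \<beta> / (f \<bullet> e)" if "x \<in> C" for x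
  proof -
    have "x \<bullet> f = (f \<bullet> e) * (x \<bullet> e)" by (subst fe) simp
    then show ?thesis using f(3)[OF that] neg by (simp add: field_simps)
  qed
  define K where "K = max \<bar>\<alpha>\<bar> \<bar>\<beta> / (f \<bullet> e)\<bar>"
  have K: "\<bar>x \<bullet> e\<bar> \<le> K" if "x \<in> C" for x
    using up[OF that] e(3)[OF that] unfolding K_def by linarith
  have unb: "\<exists>x\<in>C. x \<bullet> g > M" if g: "g \<bullet> e = 0" "norm g = 1" for g M
  proof (rule ccontr)
    assume "\<not> ?thesis"
    then have le: "x \<bullet> (- g) \<ge> - M" if "x \<in> C" for x using that by force
    have gg: "g \<bullet> g = 1" using g(2) by (simp add: norm_eq_1)
    have gf: "g \<bullet> f = 0" by (subst fe) (simp add: g)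
    define r where "r = \<bar>M\<bar> + \<bar>a \<bullet> g\<bar> + \<bar>b \<bullet> g\<bar> + 1"
    have "connected_component (- C) (a + r *\<^sub>R g) (b + r *\<^sub>R g)"
      by (rule cc[of _ "- g" "- M"]) (use le in \<open>auto simp: inner_add_left gg r_def\<close>)
    moreover have "connected_component (- C) a (a + r *\<^sub>R g)"
      by (rule cc[of _ e \<alpha>]) (use e g in \<open>auto simp: inner_add_left intro: less_imp_le\<close>)
    moreover have "connected_component (- C) b (b + r *\<^sub>R g)"
      by (rule cc[of _ f \<beta>]) (use f gf in \<open>auto simp: inner_add_left intro: less_imp_le\<close>)
    ultimately show False
      using ab(3) connected_component_sym connected_component_trans by blast
  qed
  obtain c where c: "c \<in> C" using ne by blast
  have "x \<in> C" if "x \<bullet> e = c \<bullet> e" for x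
  proof -
    define t where "t = (x - c) \<bullet> \<tau>"
    have x: "x = c + t *\<^sub>R \<tau>"
      using orthonormal_decomp[OF o, of "x - c"] that by (simp add: t_def inner_diff_left algebra_simps)
    show ?thesis
    proof (cases "t \<ge> 0")
      case True
      then show ?thesis unfolding x
        by (intro convex_contains_ray[OF C c o K unb]) (use o in auto)
    next
      case False
      have "c + (- t) *\<^sub>R (- \<tau>) \<in> C"
        by (rule convex_contains_ray[OF C c _ o(2) _ K unb]) (use o False in auto)
      then show ?thesis unfolding x by simp
    qed
  qed
  then show ?thesis using that[OF e(1), of "c \<bullet> e"] by blast
qed

text \<open>
  A point of the line through \<open>c\<close> is the limit of the segments from \<open>c\<close> to points of the given
  line that run off to infinity.
\<close>

lemma convex_contains_parallel_line:
  fixes C :: "(real^2) set"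
  assumes C: "closed C" "convex C" and e: "norm e = 1" and line: "{x. x \<bullet> e = a} \<subseteq> C"
    and c: "c \<in> C"
  shows "{x. x \<bullet> e = c \<bullet> e} \<subseteq> C"
proof
  fix x assume "x \<in> {x. x \<bullet> e = c \<bullet> e}"
  then have x: "x \<bullet> e = c \<bullet> e" by simp
  have ee: "e \<bullet> e = 1" using e by (simp add: norm_eq_1)
  define s where "s n = inverse (real (Suc n))" for n
  have s: "0 < s n" "s n \<le> 1" for n by (auto simp: s_def field_simps)
  define y where "y n = a *\<^sub>R e - (c \<bullet> e) *\<^sub>R e + c + (inverse (s n)) *\<^sub>R (x - c)" for n
  have "y n \<bullet> e = a" for n
    by (simp add: y_def inner_add_left inner_diff_left ee x)
  then have yC: "y n \<in> C" for n using line by auto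
  have eq: "(1 - s n) *\<^sub>R c + s n *\<^sub>R y n = x + s n *\<^sub>R (a *\<^sub>R e - (c \<bullet> e) *\<^sub>R e)" for n
    using s(1)[of n] by (simp add: y_def algebra_simps)
  have "(1 - s n) *\<^sub>R c + s n *\<^sub>R y n \<in> C" for n
    using s[of n] by (intro convexD_alt[OF C(2) c yC]) auto
  then have inC: "x + s n *\<^sub>R (a *\<^sub>R e - (c \<bullet> e) *\<^sub>R e) \<in> C" for n by (simp add: eq)
  have "s \<longlonglongrightarrow> 0" unfolding s_def[abs_def] by (rule LIMSEQ_inverse_real_of_nat)
  then have "(\<lambda>n. x + s n *\<^sub>R (a *\<^sub>R e - (c \<bullet> e) *\<^sub>R e)) \<longlonglongrightarrow> x + 0 *\<^sub>R (a *\<^sub>R e - (c \<bullet> e) *\<^sub>R e)"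
    by (intro tendsto_intros)
  then show "x \<in> C" using closed_sequentially[OF C(1) _ ] inC by fastforce
qed

section \<open>Second order calculus\<close>

lemma has_derivative_along_line:
  fixes f :: "'a::real_normed_vector \<Rightarrow> real"
  assumes "(f has_derivative f') (at (x + t *\<^sub>R i))"
  shows "((\<lambda>t. f (x + t *\<^sub>R i)) has_real_derivative f' i) (at t)"
proof -
  interpret f': bounded_linear f' using assms by (rule has_derivative_bounded_linear)
  have "((\<lambda>t. x + t *\<^sub>R i) has_derivative (\<lambda>h. h *\<^sub>R i)) (at t)"
    by (auto intro!: derivative_eq_intros)
  from has_derivative_compose[OF this assms] show ?thesis
    by (rule has_derivative_imp_has_field_derivative) (simp add: f'.scaleR)
qed

lemma partial_deriv_along_line:
  fixes f :: "'a::euclidean_space \<Rightarrow> real"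
  assumes "f differentiable at (x + t *\<^sub>R i)"
  shows "((\<lambda>t. f (x + t *\<^sub>R i)) has_real_derivative partial_deriv i f (x + t *\<^sub>R i)) (at t)"
  using has_derivative_along_line[of f "frechet_derivative f (at (x + t *\<^sub>R i))"] assms
  by (simp add: partial_deriv_def frechet_derivative_works)

text \<open>
  The expression on the left is symmetric in \<open>i\<close> and \<open>j\<close>, so this gives the symmetry of mixed second
  partial derivatives. Continuity of the second derivatives is replaced by differentiability of
  the first ones at the single point \<open>x\<close>.
\<close>

lemma second_difference_quotient:
  fixes f :: "'a::euclidean_space \<Rightarrow> real"
  assumes S: "open S" "x \<in> S" and d1: "\<And>y. y \<in> S \<Longrightarrow> f differentiable at y"
    and d2: "partial_deriv i f differentiable at x" and ij: "i \<in> Basis" "j \<in> Basis"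
  shows "((\<lambda>h. (f (x + h *\<^sub>R i + h *\<^sub>R j) - f (x + h *\<^sub>R i) - f (x + h *\<^sub>R j) + f x) / h\<^sup>2)
           \<longlongrightarrow> partial_deriv j (partial_deriv i f) x) (at_right 0)"
proof (rule tendstoI)
  fix e :: real assume e: "e > 0"
  define p where "p = partial_deriv i f"
  define D where "D = frechet_derivative p (at x)"
  have D: "(p has_derivative D) (at x)"
    using d2 by (simp add: D_def p_def frechet_derivative_works)
  interpret D: bounded_linear D using D by (rule has_derivative_bounded_linear)
  have nij: "norm i = 1" "norm j = 1" using ij by auto
  obtain d where d: "d > 0" "\<And>y. norm (y - x) < d \<Longrightarrow> norm (p y - p x - D (y - x)) \<le> e/4 * norm (y - x)"
    using D e unfolding has_derivative_at_alt by (meson divide_pos_pos zero_less_numeral)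
  obtain r where r: "r > 0" "ball x r \<subseteq> S" using S open_contains_ball by blast
  define \<delta> where "\<delta> = min d r / 2"
  have \<delta>: "\<delta> > 0" using d r by (simp add: \<delta>_def)
  have "dist ((f (x + h *\<^sub>R i + h *\<^sub>R j) - f (x + h *\<^sub>R i) - f (x + h *\<^sub>R j) + f x) / h\<^sup>2)
           (partial_deriv j p x) < e" if h: "0 < h" "h < \<delta>" for h
  proof -
    \<comment> \<open>the mean value theorem in direction \<open>i\<close>, then differentiability of \<open>p\<close> in direction \<open>j\<close>\<close>
    define g where "g s = f ((x + h *\<^sub>R j) + s *\<^sub>R i) - f (x + s *\<^sub>R i)" for s
    have nrm: "norm (s *\<^sub>R i) \<le> h" "norm (h *\<^sub>R j + s *\<^sub>R i) \<le> 2 * h" if "0 \<le> s" "s \<le> h" for s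
      using that h nij norm_triangle_ineq[of "h *\<^sub>R j" "s *\<^sub>R i"] by auto
    have close: "2 * h < d" "2 * h < r" using h by (auto simp: \<delta>_def)
    have inS: "x + s *\<^sub>R i \<in> S" "(x + h *\<^sub>R j) + s *\<^sub>R i \<in> S" if "0 \<le> s" "s \<le> h" for s
    proof -
      have "norm (s *\<^sub>R i) < r" "norm (h *\<^sub>R j + s *\<^sub>R i) < r"
        using nrm[OF that] close h by linarith+
      then have "dist x (x + s *\<^sub>R i) < r" "dist x ((x + h *\<^sub>R j) + s *\<^sub>R i) < r"
        unfolding dist_norm norm_minus_commute[of x] by (simp_all add: add.assoc)
      then show "x + s *\<^sub>R i \<in> S" "(x + h *\<^sub>R j) + s *\<^sub>R i \<in> S" using r(2) by auto
    qed
    have "\<exists>s>0. s < h \<and> g h - g 0 = (h - 0) * (p ((x + h *\<^sub>R j) + s *\<^sub>R i) - p (x + s *\<^sub>R i))"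
      by (rule MVT2[OF h(1)]) (unfold g_def p_def, intro DERIV_diff partial_deriv_along_line d1 inS; simp)
    then obtain s where s: "0 < s" "s < h" "g h - g 0 = h * (p ((x + h *\<^sub>R j) + s *\<^sub>R i) - p (x + s *\<^sub>R i))"
      by auto
    define R where "R y = p y - p x - D (y - x)" for y
    have sh: "0 \<le> s" "s \<le> h" using s by auto
    have e0: "e / 4 \<ge> 0" using e by simp
    have R1: "\<bar>R (x + s *\<^sub>R i)\<bar> \<le> e/4 * h"
      using d(2)[of "x + s *\<^sub>R i"] nrm(1)[OF sh] close h
        mult_left_mono[OF nrm(1)[OF sh] e0] by (simp add: R_def)
    have R2: "\<bar>R ((x + h *\<^sub>R j) + s *\<^sub>R i)\<bar> \<le> e/4 * (2 * h)"
      using d(2)[of "(x + h *\<^sub>R j) + s *\<^sub>R i"] nrm(2)[OF sh] close h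
        mult_left_mono[OF nrm(2)[OF sh] e0] by (simp add: R_def algebra_simps)
    have "p ((x + h *\<^sub>R j) + s *\<^sub>R i) - p (x + s *\<^sub>R i)
            = h * D j + (R ((x + h *\<^sub>R j) + s *\<^sub>R i) - R (x + s *\<^sub>R i))"
      unfolding R_def by (simp add: D.add D.scaleR algebra_simps)
    then have "g h - g 0 = h\<^sup>2 * D j + h * (R ((x + h *\<^sub>R j) + s *\<^sub>R i) - R (x + s *\<^sub>R i))"
      unfolding s(3) by (simp only: power2_eq_square distrib_left mult.assoc)
    then have "(g h - g 0) / h\<^sup>2 - D j = (R ((x + h *\<^sub>R j) + s *\<^sub>R i) - R (x + s *\<^sub>R i)) / h"
      using h(1) by (simp only: add_divide_distrib) (simp add: power2_eq_square)
    moreover have "\<bar>R ((x + h *\<^sub>R j) + s *\<^sub>R i) - R (x + s *\<^sub>R i)\<bar> \<le> e/4 * (3 * h)"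
      using R1 R2 by (simp add: abs_if split: if_splits)
    then have "\<bar>(R ((x + h *\<^sub>R j) + s *\<^sub>R i) - R (x + s *\<^sub>R i)) / h\<bar> \<le> (e/4 * (3 * h)) / h"
      unfolding abs_divide using h(1) by (simp only: abs_of_pos divide_right_mono less_imp_le)
    also have "(e/4 * (3 * h)) / h < e" using h(1) e by simp
    ultimately have "\<bar>(g h - g 0) / h\<^sup>2 - D j\<bar> < e" by simp
    moreover have "partial_deriv j p x = D j" by (simp add: partial_deriv_def D_def)
    ultimately show ?thesis
      by (simp add: g_def dist_real_def algebra_simps)
  qed
  then show "\<forall>\<^sub>F h in at_right 0. dist ((f (x + h *\<^sub>R i + h *\<^sub>R j) - f (x + h *\<^sub>R i) - f (x + h *\<^sub>R j) + f x) / h\<^sup>2)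
           (partial_deriv j (partial_deriv i f) x) < e"
    unfolding eventually_at_right_field p_def using \<delta> by blast
qed

lemma partial_deriv_commute:
  fixes f :: "'a::euclidean_space \<Rightarrow> real"
  assumes S: "open S" "x \<in> S" and d1: "\<And>y. y \<in> S \<Longrightarrow> f differentiable at y"
    and d2: "partial_deriv i f differentiable at x" "partial_deriv j f differentiable at x"
    and ij: "i \<in> Basis" "j \<in> Basis"
  shows "partial_deriv j (partial_deriv i f) x = partial_deriv i (partial_deriv j f) x"
proof -
  have "(\<lambda>h. (f (x + h *\<^sub>R j + h *\<^sub>R i) - f (x + h *\<^sub>R j) - f (x + h *\<^sub>R i) + f x) / h\<^sup>2)
      = (\<lambda>h. (f (x + h *\<^sub>R i + h *\<^sub>R j) - f (x + h *\<^sub>R i) - f (x + h *\<^sub>R j) + f x) / h\<^sup>2)"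
    by (simp add: algebra_simps)
  with second_difference_quotient[OF S d1 d2(2) ij(2,1)]
  have "((\<lambda>h. (f (x + h *\<^sub>R i + h *\<^sub>R j) - f (x + h *\<^sub>R i) - f (x + h *\<^sub>R j) + f x) / h\<^sup>2)
      \<longlongrightarrow> partial_deriv i (partial_deriv j f) x) (at_right 0)" by simp
  then show ?thesis
    using tendsto_unique[OF trivial_limit_at_right_real second_difference_quotient[OF S d1 d2(1) ij]]
    by blast
qed

lemma DERIV_local_max_second:
  fixes g g' :: "real \<Rightarrow> real"
  assumes d: "d > 0" and g: "\<And>t. \<bar>t\<bar> < d \<Longrightarrow> (g has_real_derivative g' t) (at t)"
    and g': "(g' has_real_derivative l) (at 0)"
    and mx: "\<And>t. \<bar>t\<bar> < d \<Longrightarrow> g t \<le> g 0"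
  shows "l \<le> 0"
proof (rule ccontr)
  assume "\<not> l \<le> 0"
  then have l: "l > 0" by simp
  have 0: "g' 0 = 0"
    by (rule DERIV_local_max[OF g d]) (use d mx in auto)
  obtain \<delta> where \<delta>: "\<delta> > 0" "\<And>h. 0 < h \<Longrightarrow> h < \<delta> \<Longrightarrow> g' h > 0"
    using DERIV_pos_inc_right[OF g' l] 0 by auto
  define h where "h = min d \<delta> / 2"
  have h: "0 < h" "h < d" "h < \<delta>" using d \<delta>(1) by (auto simp: h_def)
  have "\<exists>s>0. s < h \<and> g h - g 0 = (h - 0) * g' s"
    by (rule MVT2[OF h(1)]) (use h g in auto)
  then obtain s where "0 < s" "s < h" "g h - g 0 = h * g' s" by auto
  then have "g h > g 0" using h \<delta>(2)[of s] by (metis diff_gt_0_iff_gt mult_pos_pos order_less_trans)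
  then show False using mx[of h] h by simp
qed

text \<open>
  The maximum principle in the form needed for comparison with a quadratic barrier: \<open>Q\<close> is a
  quadratic polynomial given by its restrictions to the coordinate lines through \<open>x\<close>, and
  \<open>2 \<Sum> A i\<close> is its Laplacian.
\<close>

lemma no_local_max_of_pos_laplacian:
  fixes f :: "'a::euclidean_space \<Rightarrow> real"
  assumes S: "open S" "x \<in> S" and d1: "\<And>y. y \<in> S \<Longrightarrow> f differentiable at y"
    and d2: "\<And>i. i \<in> Basis \<Longrightarrow> partial_deriv i f differentiable at x"
    and Q: "\<And>i t. i \<in> Basis \<Longrightarrow> Q (x + t *\<^sub>R i) = Q x + B i * t + A i * t\<^sup>2"
    and pos: "s * laplacian f x + 2 * (\<Sum>i\<in>Basis. A i) > 0"
  shows "\<exists>y\<in>S. s * f y + Q y > s * f x + Q x"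
proof (rule ccontr)
  assume "\<not> ?thesis"
  then have mx: "s * f y + Q y \<le> s * f x + Q x" if "y \<in> S" for y using that by force
  obtain r where r: "r > 0" "ball x r \<subseteq> S" using S open_contains_ball by blast
  have "s * partial_deriv i (partial_deriv i f) x + 2 * A i \<le> 0" if i: "i \<in> Basis" for i
  proof (rule DERIV_local_max_second[OF r(1), where g = "\<lambda>t. s * f (x + t *\<^sub>R i) + Q (x + t *\<^sub>R i)"
      and g' = "\<lambda>t. s * partial_deriv i f (x + t *\<^sub>R i) + (B i + 2 * A i * t)"])
    have inS: "x + t *\<^sub>R i \<in> S" if "\<bar>t\<bar> < r" for t
      using that r i by (auto simp: dist_norm subset_iff)
    show "((\<lambda>t. s * f (x + t *\<^sub>R i) + Q (x + t *\<^sub>R i)) has_real_derivative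
         s * partial_deriv i f (x + t *\<^sub>R i) + (B i + 2 * A i * t)) (at t)" if "\<bar>t\<bar> < r" for t
      unfolding Q[OF i]
      by (rule derivative_eq_intros partial_deriv_along_line d1 inS that refl | simp)+
    show "((\<lambda>t. s * partial_deriv i f (x + t *\<^sub>R i) + (B i + 2 * A i * t)) has_real_derivative
        s * partial_deriv i (partial_deriv i f) x + 2 * A i) (at 0)"
    proof -
      have "((\<lambda>t. partial_deriv i f (x + t *\<^sub>R i)) has_real_derivative
         partial_deriv i (partial_deriv i f) x) (at 0)"
        using partial_deriv_along_line[of "partial_deriv i f" x 0 i] d2[OF i] by simp
      then show ?thesis by (auto intro!: derivative_eq_intros)
    qed
    show "s * f (x + t *\<^sub>R i) + Q (x + t *\<^sub>R i) \<le> s * f (x + 0 *\<^sub>R i) + Q (x + 0 *\<^sub>R i)" if "\<bar>t\<bar> < r" for t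
      using mx[OF inS[OF that]] by simp
  qed
  then have "(\<Sum>i\<in>Basis. s * partial_deriv i (partial_deriv i f) x + 2 * A i) \<le> 0"
    by (rule sum_nonpos)
  then show False using pos by (simp add: laplacian_def sum.distrib sum_distrib_left)
qed

section \<open>Holomorphic gradients and the Harnack inequality\<close>

text \<open>
  With \<open>A = F z0\<close>, the Cayley transform \<open>(F - A) / (F + cnj A)\<close> maps the disc to the unit disc and \<open>z0\<close>
  to \<open>0\<close>. Both inequalities restate the Schwarz lemma for it.
\<close>

lemma Harnack_holomorphic_pos:
  fixes F :: "complex \<Rightarrow> complex"
  assumes d: "d > 0" and F: "F holomorphic_on ball z0 d"
    and pos: "\<And>z. z \<in> ball z0 d \<Longrightarrow> Re (F z) > 0"
  shows "z \<in> ball z0 d \<Longrightarrow> Re (F z0) * (d - cmod (z - z0)) \<le> Re (F z) * (d + cmod (z - z0))"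
    and "cmod (deriv F z0) * d \<le> 2 * Re (F z0)"
proof -
  define A where "A = F z0"
  have A: "Re A > 0" using pos[of z0] d by (simp add: A_def)
  define G where "G w = F (z0 + of_real d * w)" for w
  define h where "h w = (G w - A) / (G w + cnj A)" for w
  have inb: "z0 + of_real d * w \<in> ball z0 d" if "norm w < 1" for w
    using that d by (simp add: dist_norm norm_mult)
  have G: "G holomorphic_on ball 0 1"
  proof -
    have "F \<circ> (\<lambda>w. z0 + of_real d * w) holomorphic_on ball 0 1"
      by (rule holomorphic_on_compose_gen[OF _ F]) (use inb in \<open>auto intro!: holomorphic_intros\<close>)
    then show ?thesis by (simp add: o_def G_def[abs_def])
  qed
  have Gpos: "Re (G w) > 0" if "norm w < 1" for w
    using pos[OF inb[OF that]] by (simp add: G_def)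
  have den: "G w + cnj A \<noteq> 0" if "norm w < 1" for w
    using Gpos[OF that] A by (auto simp: complex_eq_iff)
  have h: "h holomorphic_on ball 0 1"
    unfolding h_def[abs_def] by (intro holomorphic_intros G) (use den in auto)
  have h0: "h 0 = 0" by (simp add: h_def G_def A_def)
  have h1: "norm (h w) < 1" if "norm w < 1" for w
  proof -
    have "(cmod (G w - A))\<^sup>2 < (cmod (G w + cnj A))\<^sup>2"
      using mult_pos_pos[OF Gpos[OF that] A] unfolding cmod_power2
      by (simp add: power2_eq_square algebra_simps)
    then have "cmod (G w - A) < cmod (G w + cnj A)" by (rule power_less_imp_less_base) simp
    then show ?thesis using den[OF that] by (simp add: h_def norm_divide)
  qed
  show "Re (F z0) * (d - cmod (z - z0)) \<le> Re (F z) * (d + cmod (z - z0))" if z: "z \<in> ball z0 d"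
  proof -
    define w where "w = (z - z0) / of_real d"
    have w: "norm w < 1" "z0 + of_real d * w = z" "norm w * d = cmod (z - z0)"
      using z d by (auto simp: w_def dist_norm norm_divide norm_minus_commute)
    have Gw: "G w = F z" by (simp add: G_def w)
    have hw: "norm (h w) \<le> norm w" using Schwarz_Lemma(1)[OF h h0 h1 w(1)] .
    then have "cmod (G w - A) \<le> cmod w * cmod (G w + cnj A)"
      using den[OF w(1)] by (simp add: h_def norm_divide divide_le_eq)
    then have "(cmod (G w - A))\<^sup>2 \<le> (cmod w)\<^sup>2 * (cmod (G w + cnj A))\<^sup>2"
      by (metis norm_ge_zero power_mono power_mult_distrib)
    then have "(Re (G w) - Re A)\<^sup>2 + (Im (G w) - Im A)\<^sup>2
                 \<le> (cmod w)\<^sup>2 * (Re (G w) + Re A)\<^sup>2 + (cmod w)\<^sup>2 * (Im (G w) - Im A)\<^sup>2"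
      by (simp add: cmod_power2 algebra_simps)
    moreover have "(cmod w)\<^sup>2 * (Im (G w) - Im A)\<^sup>2 \<le> 1 * (Im (G w) - Im A)\<^sup>2"
      using w(1) by (intro mult_right_mono) (auto simp: power_le_one)
    ultimately have "(Re (G w) - Re A)\<^sup>2 \<le> (cmod w * (Re (G w) + Re A))\<^sup>2"
      by (simp add: power_mult_distrib)
    then have "\<bar>Re (G w) - Re A\<bar> \<le> cmod w * (Re (G w) + Re A)"
      by (rule power2_le_imp_le[of "\<bar>Re (G w) - Re A\<bar>", simplified power2_abs])
         (use Gpos[OF w(1)] A in simp)
    then have "Re A * (1 - cmod w) \<le> Re (G w) * (1 + cmod w)"
      by (simp add: algebra_simps abs_le_iff)
    then have "d * (Re A * (1 - cmod w)) \<le> d * (Re (G w) * (1 + cmod w))"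
      using d by simp
    then show ?thesis by (simp add: Gw A_def w(3)[symmetric] algebra_simps)
  qed
  have dF: "(F has_field_derivative deriv F z0) (at (z0 + of_real d * 0))"
    using holomorphic_derivI[OF F open_ball, of z0] d by simp
  have dG: "(G has_field_derivative deriv F z0 * of_real d) (at 0)"
    unfolding G_def[abs_def] by (rule DERIV_chain2[where g = "\<lambda>w. z0 + of_real d * w", OF dF]) (auto intro!: derivative_eq_intros)
  have G0: "G 0 = A" by (simp add: G_def A_def)
  have "(h has_field_derivative (deriv F z0 * of_real d) / (A + cnj A)) (at 0)"
    unfolding h_def[abs_def] using den[of 0] A
    by (auto intro!: derivative_eq_intros dG simp: G0)
  then have "deriv h 0 = (deriv F z0 * of_real d) / (A + cnj A)" by (rule DERIV_imp_deriv)
  moreover have "norm (deriv h 0) \<le> 1"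
    using Schwarz_Lemma(2)[OF h h0 h1, of 0] by simp
  moreover have "norm (A + cnj A) = 2 * Re A" using A by (simp add: complex_add_cnj)
  ultimately have "cmod (deriv F z0) * d / (2 * Re A) \<le> 1"
    using d by (simp add: norm_divide norm_mult)
  then show "cmod (deriv F z0) * d \<le> 2 * Re (F z0)"
    using A by (simp add: A_def)
qed

text \<open>
  Real part \<open>0\<close> is reached by adding a small positive constant to \<open>F\<close> and letting it tend to \<open>0\<close>.
\<close>

lemma Harnack_holomorphic:
  fixes F :: "complex \<Rightarrow> complex"
  assumes d: "d > 0" and F: "F holomorphic_on ball z0 d"
    and pos: "\<And>z. z \<in> ball z0 d \<Longrightarrow> Re (F z) \<ge> 0"
  shows "z \<in> ball z0 d \<Longrightarrow> Re (F z0) * (d - cmod (z - z0)) \<le> Re (F z) * (d + cmod (z - z0))"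
    and "cmod (deriv F z0) * d \<le> 2 * Re (F z0)"
proof -
  have hol: "(\<lambda>z. F z + of_real e) holomorphic_on ball z0 d" for e
    by (intro holomorphic_intros F)
  show "Re (F z0) * (d - cmod (z - z0)) \<le> Re (F z) * (d + cmod (z - z0))" if z: "z \<in> ball z0 d"
  proof (rule field_le_epsilon)
    fix e :: real assume e: "e > 0"
    define e' where "e' = e / (2 * d)"
    have e': "e' > 0" "e' * (2 * d) = e" using e d by (auto simp: e'_def)
    have "Re (F z0 + of_real e') * (d - cmod (z - z0)) \<le> Re (F z + of_real e') * (d + cmod (z - z0))"
      by (rule Harnack_holomorphic_pos(1)[OF d hol _ z]) (use pos e' in \<open>auto intro: add_nonneg_pos\<close>)
    moreover have "e' * cmod (z - z0) \<le> e' * d"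
      using z e' by (intro mult_left_mono) (auto simp: dist_norm norm_minus_commute)
    ultimately show "Re (F z0) * (d - cmod (z - z0)) \<le> Re (F z) * (d + cmod (z - z0)) + e"
      using e'(2) by (simp add: algebra_simps)
  qed
  show "cmod (deriv F z0) * d \<le> 2 * Re (F z0)"
  proof (rule field_le_epsilon)
    fix e :: real assume e: "e > 0"
    have "(F has_field_derivative deriv F z0) (at z0)"
      using holomorphic_derivI[OF F open_ball, of z0] d by simp
    then have "((\<lambda>z. F z + of_real (e/2)) has_field_derivative deriv F z0) (at z0)"
      by (auto intro!: derivative_eq_intros)
    then have "deriv (\<lambda>z. F z + of_real (e/2)) z0 = deriv F z0" by (rule DERIV_imp_deriv)
    moreover have "cmod (deriv (\<lambda>z. F z + of_real (e/2)) z0) * d \<le> 2 * Re (F z0 + of_real (e/2))"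
      by (rule Harnack_holomorphic_pos(2)[OF d hol]) (use pos e in \<open>auto intro: add_nonneg_pos\<close>)
    ultimately show "cmod (deriv F z0) * d \<le> 2 * Re (F z0) + e" by simp
  qed
qed

definition plane_of :: "complex \<Rightarrow> real^2" where "plane_of z = vector [Re z, Im z]"
definition complex_of :: "real^2 \<Rightarrow> complex" where "complex_of x = Complex (x$1) (x$2)"

lemma complex_of_plane_of [simp]: "complex_of (plane_of z) = z" and plane_of_complex_of [simp]: "plane_of (complex_of x) = x"
  by (simp_all add: plane_of_def complex_of_def vec_eq_iff forall_2)

lemma plane_of_linear: "plane_of (a + b) = plane_of a + plane_of b" "plane_of (a - b) = plane_of a - plane_of b" "plane_of (r *\<^sub>R a) = r *\<^sub>R plane_of a"
  by (simp_all add: plane_of_def vec_eq_iff forall_2)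

lemma complex_of_linear: "complex_of (x + y) = complex_of x + complex_of y" "complex_of (x - y) = complex_of x - complex_of y" "complex_of (r *\<^sub>R x) = r *\<^sub>R complex_of x"
  by (simp_all add: complex_of_def complex_eq_iff)

lemma norm_plane_of [simp]: "norm (plane_of z) = cmod z" and norm_complex_of [simp]: "cmod (complex_of x) = norm x"
  by (simp_all add: plane_of_def complex_of_def norm_vec_def L2_set_def sum_2 cmod_def)

lemma dist_plane_of [simp]: "dist (plane_of z) (plane_of w) = dist z w" and dist_complex_of [simp]: "dist (complex_of x) (complex_of y) = dist x y"
  by (simp_all add: dist_norm flip: plane_of_linear complex_of_linear)

lemma bounded_linear_plane_of: "bounded_linear plane_of" and bounded_linear_complex_of: "bounded_linear complex_of"
  by (rule bounded_linear_intro[where K=1]; simp add: plane_of_linear complex_of_linear)+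

lemma inner_plane_of: "x \<bullet> plane_of z = Re (cnj (complex_of x) * z)"
  by (simp add: plane_of_def complex_of_def inner_vec_def sum_2)

lemma Basis_real2: "(Basis :: (real^2) set) = {axis 1 1, axis 2 1}"
  by (auto simp: Basis_vec_def UNIV_2)

lemma sum_Basis_real2: "(\<Sum>i\<in>(Basis :: (real^2) set). g i) = g (axis 1 1) + g (axis 2 1)"
  by (simp add: Basis_real2 axis_eq_axis)

lemma grad_inner:
  assumes "f differentiable at x"
  shows "(f has_derivative (\<lambda>h. grad f x \<bullet> h)) (at x)"
proof -
  have D: "(f has_derivative frechet_derivative f (at x)) (at x)"
    using assms by (simp add: frechet_derivative_works)
  interpret bounded_linear "frechet_derivative f (at x)" using D by (rule has_derivative_bounded_linear)
  have "grad f x \<bullet> h = frechet_derivative f (at x) h" for h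
  proof -
    have "frechet_derivative f (at x) h = frechet_derivative f (at x) (\<Sum>i\<in>Basis. (h \<bullet> i) *\<^sub>R i)"
      by (simp add: euclidean_representation)
    also have "\<dots> = (\<Sum>i\<in>Basis. (h \<bullet> i) * frechet_derivative f (at x) i)"
      by (simp add: sum scaleR)
    finally show ?thesis
      by (simp add: grad_def partial_deriv_def inner_sum_left inner_commute[of h] mult.commute)
  qed
  with D show ?thesis by (simp add: fun_eq_iff[symmetric])
qed

lemma grad_nth: "grad f x $ 1 = partial_deriv (axis 1 1) f x" "grad f x $ 2 = partial_deriv (axis 2 1) f x"
  for f :: "real^2 \<Rightarrow> real"
  by (simp_all add: grad_def sum_Basis_real2 axis_def)

locale planar_harmonic =
  fixes S :: "(real^2) set" and u :: "real^2 \<Rightarrow> real"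
  assumes open_S: "open S"
    and diff1: "\<And>x. x \<in> S \<Longrightarrow> u differentiable at x"
    and diff2: "\<And>i x. i \<in> Basis \<Longrightarrow> x \<in> S \<Longrightarrow> partial_deriv i u differentiable at x"
    and harmonic: "\<And>x. x \<in> S \<Longrightarrow> laplacian u x = 0"
begin

text \<open>The function \<open>u\<^sub>x - i u\<^sub>y\<close>.\<close>

definition cgrad :: "complex \<Rightarrow> complex"
  where "cgrad z = cnj (complex_of (grad u (plane_of z)))"

text \<open>
  The Cauchy-Riemann equations for \<open>u\<^sub>x - i u\<^sub>y\<close> are \<open>\<Delta> u = 0\<close> and the symmetry of the second
  derivatives.
\<close>

lemma cgrad_holomorphic: "cgrad holomorphic_on (plane_of -` S)"
proof -
  have "cgrad field_differentiable (at z)" if z: "plane_of z \<in> S" for z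
  proof -
    define x where "x = plane_of z"
    have x: "x \<in> S" using z by (simp add: x_def)
    define P Q where "P = partial_deriv (axis 1 1) u" and "Q = partial_deriv (axis 2 1) u"
    have B: "axis 1 1 \<in> (Basis::(real^2) set)" "axis 2 1 \<in> (Basis::(real^2) set)"
      by (auto simp: Basis_real2)
    have dP: "(P has_derivative (\<lambda>h. grad P x \<bullet> h)) (at x)" and dQ: "(Q has_derivative (\<lambda>h. grad Q x \<bullet> h)) (at x)"
      unfolding P_def Q_def by (intro grad_inner diff2 B x)+
    have CR1: "grad Q x $ 2 = - grad P x $ 1"
      using harmonic[OF x] by (simp add: laplacian_def sum_Basis_real2 P_def Q_def grad_nth)
    have CR2: "grad P x $ 2 = grad Q x $ 1"
      using partial_deriv_commute[OF open_S x diff1 diff2 diff2 B, OF _ B(1) x B(2) x]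
      by (simp add: P_def Q_def grad_nth)
    have lcv: "(plane_of has_derivative plane_of) (at z)"
      by (rule bounded_linear_imp_has_derivative[OF bounded_linear_plane_of])
    have dPc: "((\<lambda>z. P (plane_of z)) has_derivative (\<lambda>h. grad P x \<bullet> plane_of h)) (at z)"
      using has_derivative_compose[OF lcv dP[unfolded x_def]] by (simp add: x_def)
    have dQc: "((\<lambda>z. Q (plane_of z)) has_derivative (\<lambda>h. grad Q x \<bullet> plane_of h)) (at z)"
      using has_derivative_compose[OF lcv dQ[unfolded x_def]] by (simp add: x_def)
    have cg: "cgrad = (\<lambda>z. of_real (P (plane_of z)) - \<i> * of_real (Q (plane_of z)))"
      by (simp add: fun_eq_iff cgrad_def complex_of_def grad_nth P_def Q_def complex_eq_iff)
    have "(cgrad has_derivative (\<lambda>h. of_real (grad P x \<bullet> plane_of h) - \<i> * of_real (grad Q x \<bullet> plane_of h))) (at z)"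
      unfolding cg by (intro derivative_intros dPc dQc)
    moreover have "(\<lambda>h. of_real (grad P x \<bullet> plane_of h) - \<i> * of_real (grad Q x \<bullet> plane_of h))
        = (*) (Complex (grad P x $ 1) (- grad Q x $ 1))"
      by (simp add: fun_eq_iff complex_eq_iff plane_of_def inner_vec_def sum_2 CR1 CR2 algebra_simps)
    ultimately have "(cgrad has_field_derivative Complex (grad P x $ 1) (- grad Q x $ 1)) (at z)"
      by (simp add: has_field_derivative_def)
    then show ?thesis by (auto simp: field_differentiable_def)
  qed
  then show ?thesis
    by (auto simp: holomorphic_on_def intro: field_differentiable_at_within)
qed

text \<open>
  On a disc the holomorphic gradient has a primitive, and the real part of the primitive has the
  same gradient as \<open>u\<close>.
\<close>

lemma conjugate_on_ball:
  assumes sub: "ball x0 d \<subseteq> S"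
  obtains F where "\<And>z. z \<in> ball (complex_of x0) d \<Longrightarrow> (F has_field_derivative cgrad z) (at z)"
    "\<And>z. z \<in> ball (complex_of x0) d \<Longrightarrow> Re (F z) = u (plane_of z)"
proof -
  have inb: "plane_of z \<in> ball x0 d" if "z \<in> ball (complex_of x0) d" for z
    using that dist_plane_of[of "complex_of x0" z] by (simp del: dist_plane_of)
  have hol: "cgrad holomorphic_on ball (complex_of x0) d"
    by (rule holomorphic_on_subset[OF cgrad_holomorphic]) (use inb sub in blast)
  obtain F where F: "\<And>z. z \<in> ball (complex_of x0) d \<Longrightarrow> (F has_field_derivative cgrad z) (at z within ball (complex_of x0) d)"
    using holomorphic_convex_primitive'[OF convex_ball open_ball hol] by metis
  have F': "(F has_field_derivative cgrad z) (at z)" if "z \<in> ball (complex_of x0) d" for z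
    using F[OF that] that by (simp add: at_within_open[OF _ open_ball])
  have "\<exists>c. \<forall>z\<in>ball (complex_of x0) d. Re (F z) - u (plane_of z) = c"
  proof (rule has_derivative_zero_constant[OF convex_ball])
    fix z assume z: "z \<in> ball (complex_of x0) d"
    have x: "plane_of z \<in> S" using inb[OF z] sub by blast
    have 1: "((\<lambda>z. Re (F z)) has_derivative (\<lambda>h. Re (cgrad z * h))) (at z)"
      using F'[OF z] unfolding has_field_derivative_def by (rule has_derivative_Re)
    have 2: "((\<lambda>z. u (plane_of z)) has_derivative (\<lambda>h. grad u (plane_of z) \<bullet> plane_of h)) (at z)"
      by (rule has_derivative_compose[OF bounded_linear_imp_has_derivative[OF bounded_linear_plane_of]
            grad_inner[OF diff1[OF x]]])
    have "((\<lambda>z. Re (F z) - u (plane_of z)) has_derivative (\<lambda>h. 0)) (at z)"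
      using has_derivative_diff[OF 1 2] by (simp add: cgrad_def inner_plane_of)
    then show "((\<lambda>z. Re (F z) - u (plane_of z)) has_derivative (\<lambda>h. 0)) (at z within ball (complex_of x0) d)"
      by (rule has_derivative_at_withinI)
  qed
  then obtain c where c: "\<And>z. z \<in> ball (complex_of x0) d \<Longrightarrow> Re (F z) - u (plane_of z) = c" by blast
  show ?thesis
  proof (rule that[of "\<lambda>z. F z - of_real c"])
    show "((\<lambda>z. F z - of_real c) has_field_derivative cgrad z) (at z)" if "z \<in> ball (complex_of x0) d" for z
      using F'[OF that] by (auto intro!: derivative_eq_intros)
  qed (use c in force)
qed

text \<open>
  Harnack's inequality for the sum of an affine function and a multiple of \<open>u\<close>. It is used for
  \<open>1 - u\<close>, for \<open>1 + u\<close>, and for the difference between \<open>u\<close> and a linear solution.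
\<close>

lemma Harnack_affine:
  assumes d: "d > 0" and sub: "ball x0 d \<subseteq> S"
    and pos: "\<And>x. x \<in> ball x0 d \<Longrightarrow> a + b \<bullet> x + s * u x \<ge> 0"
  shows "x \<in> ball x0 d \<Longrightarrow> (a + b \<bullet> x0 + s * u x0) * (d - dist x x0) \<le> (a + b \<bullet> x + s * u x) * (d + dist x x0)"
    and "norm (b + s *\<^sub>R grad u x0) * d \<le> 2 * (a + b \<bullet> x0 + s * u x0)"
proof -
  obtain F where F: "\<And>z. z \<in> ball (complex_of x0) d \<Longrightarrow> (F has_field_derivative cgrad z) (at z)"
    "\<And>z. z \<in> ball (complex_of x0) d \<Longrightarrow> Re (F z) = u (plane_of z)"
    using conjugate_on_ball[OF sub] by metis
  define G where "G z = of_real a + cnj (complex_of b) * z + of_real s * F z" for z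
  have G': "(G has_field_derivative cnj (complex_of b) + of_real s * cgrad z) (at z)" if "z \<in> ball (complex_of x0) d" for z
    unfolding G_def[abs_def] by (rule derivative_eq_intros F[OF that] refl | simp)+
  have hol: "G holomorphic_on ball (complex_of x0) d"
    using G' by (meson field_differentiable_at_within field_differentiable_def holomorphic_on_def)
  have ReG: "Re (G z) = a + b \<bullet> plane_of z + s * u (plane_of z)" if "z \<in> ball (complex_of x0) d" for z
    by (simp add: G_def inner_plane_of F(2)[OF that])
  have inb: "plane_of z \<in> ball x0 d" if "z \<in> ball (complex_of x0) d" for z
    using that dist_plane_of[of "complex_of x0" z] by (simp del: dist_plane_of)
  have pos': "Re (G z) \<ge> 0" if "z \<in> ball (complex_of x0) d" for z
    using pos[OF inb[OF that]] ReG[OF that] by simp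
  have c: "complex_of x0 \<in> ball (complex_of x0) d" using d by simp
  show "(a + b \<bullet> x0 + s * u x0) * (d - dist x x0) \<le> (a + b \<bullet> x + s * u x) * (d + dist x x0)"
    if x: "x \<in> ball x0 d"
  proof -
    have vx: "complex_of x \<in> ball (complex_of x0) d" using x by simp
    show ?thesis
      using Harnack_holomorphic(1)[OF d hol pos' vx] by (simp add: ReG[OF vx] ReG[OF c] dist_norm flip: complex_of_linear)
  qed
  have "deriv G (complex_of x0) = cnj (complex_of b) + of_real s * cgrad (complex_of x0)"
    by (rule DERIV_imp_deriv[OF G'[OF c]])
  also have "\<dots> = cnj (complex_of (b + s *\<^sub>R grad u x0))"
    by (simp add: cgrad_def complex_of_linear) (simp add: scaleR_conv_of_real)
  finally have "cmod (deriv G (complex_of x0)) = norm (b + s *\<^sub>R grad u x0)" by simp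
  then show "norm (b + s *\<^sub>R grad u x0) * d \<le> 2 * (a + b \<bullet> x0 + s * u x0)"
    using Harnack_holomorphic(2)[OF d hol pos'] ReG[OF c] by simp
qed

end

section \<open>The gradient bound\<close>

text \<open>
  \<open>G\<close> is the gradient of \<open>u\<close> on \<open>S\<close> together with its continuous boundary values, so that the condition at
  the free boundary becomes a statement about a continuous vector field.
\<close>

locale free_boundary_solution = planar_harmonic S u for S u +
  fixes G :: "real^2 \<Rightarrow> real^2"
  assumes S_eq: "S = {x. -1 < u x \<and> u x < 1}"
    and boundary: "smooth_boundary S"
    and cont_u: "continuous_on UNIV u"
    and outside: "\<And>x. x \<notin> S \<Longrightarrow> u x = 1 \<or> u x = -1"
    and cont_G: "continuous_on (closure S) G"
    and G_grad: "\<And>x. x \<in> S \<Longrightarrow> G x = grad u x"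
    and norm_G: "\<And>x. x \<in> frontier S \<Longrightarrow> norm (G x) = 1"
    and S_ne: "S \<noteq> {}" "S \<noteq> UNIV"
begin

lemma u_bounds: "-1 \<le> u x" "u x \<le> 1"
  using outside[of x] S_eq by force+

lemma frontier_S: "x \<in> frontier S \<longleftrightarrow> x \<in> closure S \<and> x \<notin> S"
  using open_S by (auto simp: frontier_def interior_open)

lemma u_frontier: "x \<in> frontier S \<Longrightarrow> u x = 1 \<or> u x = -1"
  using outside frontier_S by blast

lemma isCont_u: "isCont u x"
  using cont_u continuous_on_eq_continuous_at open_UNIV by blast

lemma cont_u_on [continuous_intros]:
  "continuous_on A f \<Longrightarrow> continuous_on A (\<lambda>t. u (f t))"
  by (rule continuous_on_compose2[OF cont_u]) auto

lemma u_along_line: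
  assumes "x + t *\<^sub>R \<xi> \<in> S"
  shows "((\<lambda>t. u (x + t *\<^sub>R \<xi>)) has_real_derivative grad u (x + t *\<^sub>R \<xi>) \<bullet> \<xi>) (at t)"
  using has_derivative_along_line[OF grad_inner[OF diff1[OF assms]]] .

text \<open>
  A growth bound along a ray that enters \<open>S\<close> at the boundary point \<open>q\<close> bounds the slope of \<open>u\<close> there.
  The sign \<open>s\<close> makes the lemma yield lower bounds as well; the quadratic term leaves room for
  quadratic barriers.
\<close>

lemma boundary_slope_le:
  assumes q: "q \<in> frontier S" and t0: "t0 > 0"
    and inS: "\<And>t. 0 < t \<Longrightarrow> t < t0 \<Longrightarrow> q + t *\<^sub>R \<xi> \<in> S"
    and le: "\<And>t. 0 < t \<Longrightarrow> t < t0 \<Longrightarrow> s * (u (q + t *\<^sub>R \<xi>) - u q) \<le> c * t + K * t\<^sup>2"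
  shows "s * (G q \<bullet> \<xi>) \<le> c"
proof -
  have lim: "((\<lambda>t. (u (q + t *\<^sub>R \<xi>) - u q) / t) \<longlongrightarrow> G q \<bullet> \<xi>) (at_right 0)"
  proof (rule tendstoI)
    fix e :: real assume e: "e > 0"
    have "q \<in> closure S" using q frontier_S by blast
    then obtain d where d: "d > 0" "\<And>x. x \<in> closure S \<Longrightarrow> dist x q < d \<Longrightarrow> dist (G x) (G q) < e / (norm \<xi> + 1)"
      using cont_G e unfolding continuous_on_iff
      by (metis add_nonneg_pos divide_pos_pos norm_ge_zero zero_less_one)
    define \<delta> where "\<delta> = min t0 (d / (norm \<xi> + 1))"
    have \<delta>: "\<delta> > 0" using t0 d(1) by (simp add: \<delta>_def add_nonneg_pos)
    have "dist ((u (q + t *\<^sub>R \<xi>) - u q) / t) (G q \<bullet> \<xi>) < e" if t: "0 < t" "t < \<delta>" for t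
    proof -
      have tt: "t < t0" "t < d / (norm \<xi> + 1)" using t by (auto simp: \<delta>_def)
      obtain r where r: "0 < r" "r < t" "u (q + t *\<^sub>R \<xi>) - u (q + 0 *\<^sub>R \<xi>) = grad u (q + r *\<^sub>R \<xi>) \<bullet> \<xi> * (t - 0)"
      proof (rule mvt[OF t(1), where f = "\<lambda>t. u (q + t *\<^sub>R \<xi>)" and f' = "\<lambda>r h. grad u (q + r *\<^sub>R \<xi>) \<bullet> \<xi> * h"])
        show "continuous_on {0..t} (\<lambda>t. u (q + t *\<^sub>R \<xi>))" by (intro continuous_intros)
        show "((\<lambda>t. u (q + t *\<^sub>R \<xi>)) has_derivative (\<lambda>h. grad u (q + x *\<^sub>R \<xi>) \<bullet> \<xi> * h)) (at x)"
          if "0 < x" "x < t" for x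
          using u_along_line[OF inS[of x]] that tt by (simp add: has_field_derivative_def)
      qed blast
      have rS: "q + r *\<^sub>R \<xi> \<in> S" using inS[of r] r tt by simp
      have "r * norm \<xi> \<le> r * (norm \<xi> + 1)" using r by (intro mult_left_mono) auto
      also have "\<dots> < d / (norm \<xi> + 1) * (norm \<xi> + 1)"
        using r tt by (intro mult_strict_right_mono) (auto intro: add_nonneg_pos)
      also have "\<dots> = d" by (simp add: add_nonneg_eq_0_iff)
      finally have "dist (q + r *\<^sub>R \<xi>) q < d" using r(1) by (simp add: dist_norm)
      then have gd: "dist (G (q + r *\<^sub>R \<xi>)) (G q) < e / (norm \<xi> + 1)"
        using d(2) rS closure_subset by blast
      have "(u (q + t *\<^sub>R \<xi>) - u q) / t - G q \<bullet> \<xi> = (G (q + r *\<^sub>R \<xi>) - G q) \<bullet> \<xi>"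
        using r t(1) G_grad[OF rS] by (simp add: inner_diff_left)
      moreover have "\<bar>(G (q + r *\<^sub>R \<xi>) - G q) \<bullet> \<xi>\<bar> \<le> norm (G (q + r *\<^sub>R \<xi>) - G q) * norm \<xi>"
        by (rule Cauchy_Schwarz_ineq2)
      moreover have "\<dots> \<le> norm (G (q + r *\<^sub>R \<xi>) - G q) * (norm \<xi> + 1)"
        by (intro mult_left_mono) auto
      moreover have "norm (G (q + r *\<^sub>R \<xi>) - G q) * (norm \<xi> + 1) < e"
        using gd by (simp add: dist_norm pos_less_divide_eq add_nonneg_pos)
      ultimately show ?thesis by (simp add: dist_real_def)
    qed
    then show "\<forall>\<^sub>F t in at_right 0. dist ((u (q + t *\<^sub>R \<xi>) - u q) / t) (G q \<bullet> \<xi>) < e"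
      unfolding eventually_at_right_field using \<delta> by blast
  qed
  have lim1: "((\<lambda>t. s * ((u (q + t *\<^sub>R \<xi>) - u q) / t)) \<longlongrightarrow> s * (G q \<bullet> \<xi>)) (at_right 0)"
    by (intro tendsto_intros lim)
  have "((\<lambda>t. c + K * t) \<longlongrightarrow> c + K * 0) (at_right (0::real))"
    by (intro tendsto_intros)
  then have lim2: "((\<lambda>t. c + K * t) \<longlongrightarrow> c) (at_right (0::real))" by simp
  have "\<forall>\<^sub>F t in at_right 0. s * ((u (q + t *\<^sub>R \<xi>) - u q) / t) \<le> c + K * t"
    unfolding eventually_at_right_field
  proof (intro exI[of _ t0] conjI allI impI t0)
    fix t :: real assume t: "0 < t" "t < t0"
    show "s * ((u (q + t *\<^sub>R \<xi>) - u q) / t) \<le> c + K * t"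
      using le[OF t] t(1) by (simp add: pos_divide_le_eq algebra_simps power2_eq_square)
  qed
  then show ?thesis
    by (rule tendsto_le[OF trivial_limit_at_right_real lim2 lim1])
qed

text \<open>
  Let \<open>y\<close> be a nearest point to \<open>x\<close> outside \<open>S\<close>, let \<open>d\<close> be its distance, \<open>\<sigma> = u y\<close>, and
  \<open>w = 1 - \<sigma> u \<ge> 0\<close>. By Harnack's inequality \<open>w\<close> grows at \<open>y\<close> towards \<open>x\<close> with slope at least
  \<open>w x / (2 d)\<close>, while the slope is at most \<open>1\<close>. So \<open>w x \<le> 2 d\<close>, and the interior gradient
  estimate \<open>2 (w x) / d\<close> is at most \<open>4\<close>.
\<close>

lemma grad_le_4:
  assumes x: "x \<in> S"
  shows "norm (grad u x) \<le> 4"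
proof -
  have cl: "closed (- S)" "- S \<noteq> {}" using open_S S_ne by auto
  define y where "y = closest_point (- S) x"
  have y: "y \<notin> S" "\<And>z. z \<notin> S \<Longrightarrow> dist x y \<le> dist x z"
    using closest_point_exists[OF cl, of x] by (auto simp: y_def)
  define d where "d = dist x y"
  have d: "d > 0" using x y(1) by (auto simp: d_def)
  have sub: "ball x d \<subseteq> S" using y(2) by (force simp: d_def)
  have "y \<in> closure (ball x d)" using d by (simp add: d_def)
  then have yf: "y \<in> frontier S"
    using closure_mono[OF sub] y(1) by (auto simp: frontier_S)
  define \<sigma> where "\<sigma> = u y"
  have \<sigma>: "\<sigma> = 1 \<or> \<sigma> = -1" "\<sigma> * \<sigma> = 1" using u_frontier[OF yf] by (auto simp: \<sigma>_def)
  have pos: "1 + 0 \<bullet> z + (- \<sigma>) * u z \<ge> 0" for z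
    using u_bounds[of z] \<sigma>(1) by auto
  define w where "w = 1 - \<sigma> * u x"
  define \<xi> where "\<xi> = (x - y) /\<^sub>R d"
  have n\<xi>: "norm \<xi> = 1" using d by (simp add: \<xi>_def d_def dist_norm)
  have "\<sigma> * (G y \<bullet> \<xi>) \<le> - (w / (2 * d))"
  proof (rule boundary_slope_le[OF yf d, where K = 0])
    fix t assume t: "0 < t" "t < d"
    have "(y + t *\<^sub>R \<xi>) - x = (t - d) *\<^sub>R \<xi>" using d by (simp add: \<xi>_def algebra_simps)
    then have dst: "dist (y + t *\<^sub>R \<xi>) x = d - t" using t n\<xi> by (simp add: dist_norm)
    then have inb: "y + t *\<^sub>R \<xi> \<in> ball x d" using t by (simp add: dist_commute)
    then show "y + t *\<^sub>R \<xi> \<in> S" using sub by blast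
    have "w * t \<le> (1 - \<sigma> * u (y + t *\<^sub>R \<xi>)) * (2 * d - t)"
      using Harnack_affine(1)[OF d sub pos inb] by (simp add: dst w_def)
    also have "\<dots> \<le> (1 - \<sigma> * u (y + t *\<^sub>R \<xi>)) * (2 * d)"
      using t pos[of "y + t *\<^sub>R \<xi>"] by (intro mult_left_mono) auto
    finally have "w * t / (2 * d) \<le> 1 - \<sigma> * u (y + t *\<^sub>R \<xi>)"
      using d by (simp add: pos_divide_le_eq)
    then show "\<sigma> * (u (y + t *\<^sub>R \<xi>) - u y) \<le> - (w / (2 * d)) * t + 0 * t\<^sup>2"
      using \<sigma>(2) by (simp add: \<sigma>_def[symmetric] algebra_simps)
  qed
  moreover have "\<bar>\<sigma> * (G y \<bullet> \<xi>)\<bar> \<le> 1"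
    using Cauchy_Schwarz_ineq2[of "G y" \<xi>] norm_G[OF yf] n\<xi> \<sigma>(1) by (auto simp: abs_mult)
  ultimately have "w / (2 * d) \<le> 1" by linarith
  then have "w \<le> 2 * d" using d by simp
  moreover have "norm (grad u x) * d \<le> 2 * w"
    using Harnack_affine(2)[OF d sub pos] \<sigma>(1) by (auto simp: w_def)
  ultimately have "norm (grad u x) * d \<le> 4 * d" by simp
  then show ?thesis using d by simp
qed

lemma frontier_ne: "frontier S \<noteq> {}"
  using S_ne frontier_eq_empty by blast

lemma graph_at_frontier:
  assumes p: "p \<in> frontier S"
  obtains r \<tau> \<nu> \<gamma> where "r > 0" "norm \<tau> = 1" "norm \<nu> = 1" "\<tau> \<bullet> \<nu> = 0"
    "\<And>t. \<gamma> differentiable (at (t::real))" "\<And>x. x \<in> ball p r \<Longrightarrow> x \<in> S \<longleftrightarrow> \<gamma> (x \<bullet> \<tau>) < x \<bullet> \<nu>"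
    "\<gamma> (p \<bullet> \<tau>) = p \<bullet> \<nu>"
proof -
  obtain r \<tau> \<nu> \<gamma> where r: "r > 0" and o: "norm \<tau> = 1" "norm \<nu> = 1" "\<tau> \<bullet> \<nu> = 0"
    and sm: "smooth_real_fun \<gamma>" and eq: "S \<inter> ball p r = {x \<in> ball p r. \<gamma> (x \<bullet> \<tau>) < x \<bullet> \<nu>}"
    using bspec[OF boundary[unfolded smooth_boundary_def] p] by (elim exE conjE)
  have diff: "\<gamma> differentiable (at t)" for t
    using spec[OF spec[OF sm[unfolded smooth_real_fun_def], of 0], of t] by (simp only: funpow_0)
  have iff: "x \<in> S \<longleftrightarrow> \<gamma> (x \<bullet> \<tau>) < x \<bullet> \<nu>" if "x \<in> ball p r" for x
    using eq that by blast
  have cont: "continuous_on UNIV \<gamma>"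
    by (intro differentiable_imp_continuous_on)
       (simp add: differentiable_on_def diff)
  have pS: "p \<notin> S" "p \<in> closure S" using p frontier_S by auto
  have "\<gamma> (p \<bullet> \<tau>) \<ge> p \<bullet> \<nu>" using iff[of p] r pS by auto
  moreover have "p \<in> {x. \<gamma> (x \<bullet> \<tau>) \<le> x \<bullet> \<nu>}"
  proof -
    have "p \<in> closure (ball p r \<inter> S)"
      using open_Int_closure_subset[OF open_ball, of p r S] pS(2) r by auto
    moreover have "closed {x. \<gamma> (x \<bullet> \<tau>) \<le> x \<bullet> \<nu>}"
      by (intro closed_Collect_le continuous_on_compose2[OF cont] continuous_intros) auto
    moreover have "ball p r \<inter> S \<subseteq> {x. \<gamma> (x \<bullet> \<tau>) \<le> x \<bullet> \<nu>}" using iff by auto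
    ultimately show ?thesis using closure_minimal by blast
  qed
  ultimately have "\<gamma> (p \<bullet> \<tau>) = p \<bullet> \<nu>" by simp
  from that[OF r o diff iff this] show ?thesis .
qed

text \<open>
  Near a boundary point \<open>S\<close> lies on one side of a graph; the other side contains a disc.
\<close>

lemma disc_outside:
  obtains p r where "r > 0" "ball p r \<inter> S = {}"
proof -
  obtain q where q: "q \<in> frontier S" using frontier_ne by blast
  obtain r \<tau> \<nu> \<gamma> where g: "r > 0" "norm \<tau> = 1" "norm \<nu> = 1" "\<tau> \<bullet> \<nu> = 0"
    "\<And>t. \<gamma> differentiable (at (t::real))" "\<And>x. x \<in> ball q r \<Longrightarrow> x \<in> S \<longleftrightarrow> \<gamma> (x \<bullet> \<tau>) < x \<bullet> \<nu>"
    "\<gamma> (q \<bullet> \<tau>) = q \<bullet> \<nu>"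
    using graph_at_frontier[OF q] by metis
  have cont: "continuous_on UNIV \<gamma>"
    by (intro differentiable_imp_continuous_on)
       (simp add: differentiable_on_def g(5))
  define x where "x = q - (r/2) *\<^sub>R \<nu>"
  define U where "U = ball q r \<inter> {x. x \<bullet> \<nu> < \<gamma> (x \<bullet> \<tau>)}"
  have "\<nu> \<bullet> \<nu> = 1" using g(3) by (simp add: norm_eq_1)
  then have "x \<in> U"
    using g(1,3,4,7) by (simp add: x_def U_def dist_norm inner_diff_left inner_commute[of \<nu> \<tau>])
  moreover have "open U" unfolding U_def
    by (intro open_Int open_ball open_Collect_less continuous_on_compose2[OF cont] continuous_intros) auto
  ultimately obtain s where s: "s > 0" "ball x s \<subseteq> U" using open_contains_ball by blast
  have "U \<inter> S = {}" using g(6) by (auto simp: U_def)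
  then show ?thesis using that[OF s(1), of x] s(2) by blast
qed

text \<open>
  Phragmen-Lindelof: with a disc of radius \<open>r\<close> around \<open>p\<close> outside \<open>S\<close>, the function
  \<open>f\<^sup>n r / (z - p)\<close> is bounded by \<open>1\<close> on the boundary of \<open>S\<close>, and it tends to \<open>0\<close> at infinity because \<open>f\<close> is
  bounded. Hence \<open>\<bar>f\<bar>\<^sup>n \<le> \<bar>z - p\<bar> / r\<close> on \<open>S\<close>, for every \<open>n\<close>.
\<close>

lemma grad_le_1:
  assumes x: "x \<in> S"
  shows "norm (grad u x) \<le> 1"
proof (rule ccontr)
  assume "\<not> ?thesis"
  then have gt: "norm (grad u x) > 1" by simp
  obtain p r where pr: "r > 0" "ball p r \<inter> S = {}" using disc_outside .
  obtain n where n: "norm (x - p) / r < norm (grad u x) ^ n"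
    using real_arch_pow[OF gt] by blast
  define T where "T = plane_of -` S"
  define f where "f z = cnj (complex_of (G (plane_of z)))" for z
  \<comment> \<open>\<open>f\<close> is the holomorphic gradient together with its boundary values\<close>
  define H where "H z = f z ^ n * of_real r / (z - complex_of p)" for z
  \<comment> \<open>beyond radius \<open>R\<close> the bound \<open>4\<close> for \<open>f\<close> suffices\<close>
  define R where "R = norm (x - p) + 4 ^ n * r + 1"
  have R: "R > 0" "norm (x - p) < R" "4 ^ n * r \<le> R"
    using pr(1) by (auto simp: R_def intro!: add_nonneg_pos)
  define U where "U = T \<inter> ball (complex_of p) R"
  have conv: "continuous_on A plane_of" for A
    by (rule bounded_linear.continuous_on[OF bounded_linear_plane_of continuous_on_id])
  have covc: "continuous_on A complex_of" for A
    by (rule bounded_linear.continuous_on[OF bounded_linear_complex_of continuous_on_id])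
  have opT: "open T" unfolding T_def by (rule open_vimage[OF open_S conv])
  have opU: "open U" using opT by (simp add: U_def open_Int)
  have clT: "plane_of z \<in> closure S" if "z \<in> closure T" for z
  proof -
    have "closed (plane_of -` closure S)" by (rule closed_vimage[OF closed_closure conv])
    moreover have "T \<subseteq> plane_of -` closure S" using closure_subset by (auto simp: T_def)
    ultimately show ?thesis using closure_minimal that by blast
  qed
  have far: "cmod (z - complex_of p) \<ge> r" if "plane_of z \<in> closure S" for z
  proof -
    have "plane_of z \<notin> ball p r"
      using that pr(2) open_Int_closure_eq_empty[OF open_ball, of p r S] by blast
    then have "dist p (plane_of z) \<ge> r" by simp
    also have "dist p (plane_of z) = cmod (z - complex_of p)"
      using dist_complex_of[of "plane_of z" p] by (simp add: dist_norm norm_minus_commute del: dist_complex_of)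
    finally show ?thesis .
  qed
  have clU: "plane_of z \<in> closure S" "z \<noteq> complex_of p" if "z \<in> closure U" for z
  proof -
    have "z \<in> closure T" using that closure_mono[of U T] by (auto simp: U_def)
    then show "plane_of z \<in> closure S" by (rule clT)
    then show "z \<noteq> complex_of p" using far[of z] pr(1) by auto
  qed
  have fT: "f z = cgrad z" if "z \<in> T" for z
    using that by (simp add: f_def cgrad_def T_def G_grad)
  have holf: "f holomorphic_on U"
    using holomorphic_on_subset[OF cgrad_holomorphic, of U] fT
    by (subst holomorphic_cong[OF refl, of _ f cgrad]) (auto simp: U_def T_def)
  have hol: "H holomorphic_on interior U"
    unfolding interior_open[OF opU] H_def[abs_def]
    by (intro holomorphic_intros holf) (use clU(2) closure_subset in auto)
  have contH: "continuous_on (closure U) H"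
  proof -
    have "continuous_on (closure U) (\<lambda>z. G (plane_of z))"
      by (rule continuous_on_compose2[OF cont_G conv]) (use clU in auto)
    then have "continuous_on (closure U) f"
      unfolding f_def[abs_def]
      by (intro continuous_intros continuous_on_compose2[OF covc[of UNIV]]) auto
    then show ?thesis unfolding H_def[abs_def]
      by (intro continuous_intros) (use clU(2) in auto)
  qed
  have normH: "cmod (H z) = norm (G (plane_of z)) ^ n * r / cmod (z - complex_of p)" for z
    using pr(1) by (simp add: H_def f_def norm_divide norm_mult norm_power)
  have "cmod (H (complex_of x)) \<le> 1"
  proof (rule maximum_modulus_frontier[OF hol contH])
    show "bounded U" unfolding U_def by (meson bounded_Int bounded_ball)
    show "complex_of x \<in> U" using x R(2) by (simp add: U_def T_def) (simp add: dist_norm norm_minus_commute)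
    fix z assume z: "z \<in> frontier U"
    then have zc: "z \<in> closure U" and zU: "z \<notin> U"
      using opU by (auto simp: frontier_def interior_open)
    show "cmod (H z) \<le> 1"
    proof (cases "z \<in> T")
      case True
      then have "cmod (z - complex_of p) \<ge> R"
        using zU by (auto simp: U_def dist_norm norm_minus_commute)
      moreover have "norm (G (plane_of z)) ^ n \<le> 4 ^ n"
        using True by (intro power_mono) (auto simp: T_def G_grad grad_le_4)
      then have "norm (G (plane_of z)) ^ n * r \<le> 4 ^ n * r" using pr(1) by simp
      ultimately have "norm (G (plane_of z)) ^ n * r \<le> cmod (z - complex_of p)" using R by linarith
      then show ?thesis unfolding normH by (simp add: divide_le_eq)
    next
      case False
      then have "plane_of z \<in> frontier S" using clU[OF zc] by (auto simp: T_def frontier_S)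
      then show ?thesis
        using far[OF clU(1)[OF zc]] by (simp add: normH norm_G divide_le_eq)
    qed
  qed
  then have "norm (grad u x) ^ n * r / norm (x - p) \<le> 1"
    by (simp add: normH G_grad[OF x] flip: complex_of_linear)
  moreover have "norm (x - p) > 0" using pr x by force
  ultimately have "norm (grad u x) ^ n \<le> norm (x - p) / r"
    using pr(1) by (simp add: divide_le_eq le_divide_eq)
  then show False using n by simp
qed

text \<open>
  On a segment, pass from the last point where \<open>u\<close> is at most \<open>u a\<close> to the first later point where
  \<open>u\<close> is at least \<open>u b\<close>. In between the values lie strictly between \<open>-1\<close> and \<open>1\<close>, so this part of
  the segment runs inside \<open>S\<close>, where the gradient bound applies.
\<close>

lemma lipschitz_aux: "u b - u a \<le> dist a b"
proof (rule ccontr)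
  assume "\<not> ?thesis"
  then have gt: "u b - u a > dist a b" by simp
  then have ab: "u a < u b" using zero_le_dist[of a b] by linarith
  define \<phi> where "\<phi> t = u (a + t *\<^sub>R (b - a))" for t
  have cont: "continuous_on A \<phi>" for A
    unfolding \<phi>_def[abs_def] by (intro continuous_intros)
  have \<phi>01: "\<phi> 0 = u a" "\<phi> 1 = u b" by (simp_all add: \<phi>_def)
  have comp: "compact {t \<in> {c..1}. \<phi> t \<le> k}" "compact {t \<in> {c..1}. k \<le> \<phi> t}" for c k
  proof -
    have "closed {t. \<phi> t \<le> k}" "closed {t. k \<le> \<phi> t}"
      by (intro closed_Collect_le cont continuous_intros)+
    then have "compact ({c..1} \<inter> {t. \<phi> t \<le> k})" "compact ({c..1} \<inter> {t. k \<le> \<phi> t})"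
      by (intro compact_Int_closed; simp)+
    then show "compact {t \<in> {c..1}. \<phi> t \<le> k}" "compact {t \<in> {c..1}. k \<le> \<phi> t}"
      by (simp_all add: Int_def)
  qed
  obtain t0 where t0: "t0 \<in> {t \<in> {0..1}. \<phi> t \<le> u a}" "\<And>t. t \<in> {t \<in> {0..1}. \<phi> t \<le> u a} \<Longrightarrow> t \<le> t0"
    using compact_attains_sup[OF comp(1)[of 0 "u a"]] \<phi>01 by force
  obtain t1 where t1: "t1 \<in> {t \<in> {t0..1}. u b \<le> \<phi> t}" "\<And>t. t \<in> {t \<in> {t0..1}. u b \<le> \<phi> t} \<Longrightarrow> t1 \<le> t"
    using compact_attains_inf[OF comp(2)[of t0 "u b"]] \<phi>01 t0(1) by force
  have lt: "t0 < t1" using t0(1) t1(1) ab by (cases "t0 = t1") auto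
  have inS: "a + t *\<^sub>R (b - a) \<in> S" if t: "t0 < t" "t < t1" for t
  proof -
    have "\<phi> t > u a" "\<phi> t < u b"
      using t0(2)[of t] t1(2)[of t] t t0(1) t1(1) by (force simp: not_le[symmetric])+
    then show ?thesis using u_bounds[of a] u_bounds[of b] unfolding S_eq \<phi>_def by auto
  qed
  obtain r where r: "t0 < r" "r < t1" "\<phi> t1 - \<phi> t0 = grad u (a + r *\<^sub>R (b - a)) \<bullet> (b - a) * (t1 - t0)"
  proof (rule mvt[OF lt cont, where f' = "\<lambda>r h. grad u (a + r *\<^sub>R (b - a)) \<bullet> (b - a) * h"])
    show "(\<phi> has_derivative (\<lambda>h. grad u (a + x *\<^sub>R (b - a)) \<bullet> (b - a) * h)) (at x)"
      if "t0 < x" "x < t1" for x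
      using u_along_line[OF inS[OF that]] by (simp add: has_field_derivative_def \<phi>_def[abs_def])
  qed blast
  have "grad u (a + r *\<^sub>R (b - a)) \<bullet> (b - a) \<le> norm (grad u (a + r *\<^sub>R (b - a))) * norm (b - a)"
    by (rule norm_cauchy_schwarz)
  also have "\<dots> \<le> 1 * norm (b - a)"
    by (intro mult_right_mono grad_le_1 inS r) auto
  finally have 1: "grad u (a + r *\<^sub>R (b - a)) \<bullet> (b - a) \<le> dist a b"
    by (simp add: dist_norm norm_minus_commute)
  have "\<phi> t1 - \<phi> t0 \<le> dist a b * (t1 - t0)"
    unfolding r(3) using 1 lt by (intro mult_right_mono) auto
  also have "\<dots> \<le> dist a b * 1"
    using t0(1) t1(1) by (intro mult_left_mono) auto
  finally show False using gt t0(1) t1(1) by auto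
qed

lemma lipschitz: "\<bar>u a - u b\<bar> \<le> dist a b"
  using lipschitz_aux[of a b] lipschitz_aux[of b a] by (simp add: dist_commute abs_le_iff)

end

section \<open>Parabolas do not touch the boundary from outside\<close>

lemma sum_inner_Basis_sq: "(\<Sum>i\<in>Basis. (i \<bullet> x)\<^sup>2) = (norm x)\<^sup>2" for x :: "'a::euclidean_space"
proof -
  have "(norm x)\<^sup>2 = x \<bullet> x" by (simp add: power2_norm_eq_inner)
  also have "\<dots> = (\<Sum>i\<in>Basis. (i \<bullet> x)\<^sup>2)"
    by (subst euclidean_inner) (simp add: inner_commute power2_eq_square)
  finally show ?thesis by simp
qed

context free_boundary_solution
begin

text \<open>
  At the boundary \<open>u\<close> has an extreme value, so its slope has a sign in all directions that point into
  \<open>S\<close>. If these form a half-plane, the gradient is normal to its edge, and its length is \<open>1\<close>.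
\<close>

lemma boundary_gradient_normal:
  assumes q: "q \<in> frontier S" and n: "norm n = 1"
    and inward: "\<And>\<xi>. \<xi> \<bullet> n > 0 \<Longrightarrow> \<exists>t0>0. \<forall>t. 0 < t \<and> t < t0 \<longrightarrow> q + t *\<^sub>R \<xi> \<in> S"
  shows "u q * (G q \<bullet> n) = -1"
proof -
  define e where "e = perp n"
  have o: "norm e = 1" "norm n = 1" "e \<bullet> n = 0" using n by (simp_all add: e_def)
  have ee: "n \<bullet> n = 1" using n by (simp add: norm_eq_1)
  define \<sigma> where "\<sigma> = u q"
  have \<sigma>: "\<sigma> = 1 \<or> \<sigma> = -1" using u_frontier[OF q] by (auto simp: \<sigma>_def)
  have slope: "\<sigma> * (G q \<bullet> \<xi>) \<le> 0" if \<xi>: "\<xi> \<bullet> n > 0" for \<xi>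
  proof -
    obtain t0 where t0: "t0 > 0" "\<forall>t. 0 < t \<and> t < t0 \<longrightarrow> q + t *\<^sub>R \<xi> \<in> S"
      using inward[OF \<xi>] by blast
    show ?thesis
    proof (rule boundary_slope_le[OF q t0(1), where K = 0])
      fix t assume "0 < t" "t < t0"
      then show "q + t *\<^sub>R \<xi> \<in> S" using t0 by blast
      show "\<sigma> * (u (q + t *\<^sub>R \<xi>) - u q) \<le> 0 * t + 0 * t\<^sup>2"
        using u_bounds[of "q + t *\<^sub>R \<xi>"] \<sigma> unfolding \<sigma>_def[symmetric] by auto
    qed
  qed
  have Gn: "\<sigma> * (G q \<bullet> n) \<le> 0" using slope[of n] ee by simp
  have Ge: "\<sigma> * (G q \<bullet> e) = 0"
  proof (rule ccontr)
    assume ne: "\<sigma> * (G q \<bullet> e) \<noteq> 0"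
    \<comment> \<open>a direction into \<open>S\<close> in which the slope would be \<open>1\<close>\<close>
    define k where "k = (1 - \<sigma> * (G q \<bullet> n)) / (\<sigma> * (G q \<bullet> e))"
    have "\<sigma> * (G q \<bullet> (n + k *\<^sub>R e)) \<le> 0"
      by (rule slope) (simp add: inner_add_left ee o)
    moreover have "\<sigma> * (G q \<bullet> (n + k *\<^sub>R e)) = \<sigma> * (G q \<bullet> n) + k * (\<sigma> * (G q \<bullet> e))"
      by (simp add: inner_add_right algebra_simps)
    moreover have "k * (\<sigma> * (G q \<bullet> e)) = 1 - \<sigma> * (G q \<bullet> n)" using ne by (simp add: k_def)
    ultimately show False by linarith
  qed
  have "(norm (G q))\<^sup>2 = (G q \<bullet> n)\<^sup>2"
    using orthonormal_norm[OF o, of "G q"] Ge \<sigma> by auto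
  then have "\<bar>G q \<bullet> n\<bar> = 1" using norm_G[OF q] by (simp add: abs_square_eq_1)
  then show ?thesis unfolding \<sigma>_def[symmetric] using Gn \<sigma> by (auto simp: abs_if split: if_splits)
qed

text \<open>
  In the orthonormal frame \<open>(e, n)\<close> at \<open>q\<close>, write \<open>X\<close> and \<open>Y\<close> for the coordinates, \<open>\<sigma> = u q\<close> and
  \<open>v = 1 - \<sigma> u\<close>. The Lipschitz bound along \<open>n\<close> gives \<open>v \<le> Y - c X\<^sup>2\<close>, and \<open>v\<close> vanishes on the boundary
  near \<open>q\<close>. The polynomial \<open>W = (1 - \<delta>) Y - (c/2) X\<^sup>2 + (c/4) Y\<^sup>2\<close> has negative Laplacian and, for
  \<open>\<delta> = c r / 4\<close>, dominates \<open>v\<close> on the boundary of \<open>S \<inter> ball q r\<close>: on the circle of radius \<open>r\<close>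
  because \<open>\<delta> Y \<le> \<delta> r = (c/4) (X\<^sup>2 + Y\<^sup>2)\<close>. So \<open>v \<le> W\<close> inside, and the normal derivative of
  \<open>v\<close> at \<open>q\<close> is at most \<open>1 - \<delta>\<close>, although it equals \<open>1\<close>.
\<close>

lemma no_touching_parabola:
  assumes q: "q \<in> frontier S" and o: "norm e = 1" "norm n = 1" "e \<bullet> n = 0"
    and c: "c > 0" and \<rho>: "\<rho> > 0"
    and touch: "\<And>x. x \<in> S \<Longrightarrow> x \<in> ball q \<rho> \<Longrightarrow> (x - q) \<bullet> n > c * ((x - q) \<bullet> e)\<^sup>2"
    and inward: "\<And>\<xi>. \<xi> \<bullet> n > 0 \<Longrightarrow> \<exists>t0>0. \<forall>t. 0 < t \<and> t < t0 \<longrightarrow> q + t *\<^sub>R \<xi> \<in> S"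
  shows False
proof -
  have ee: "e \<bullet> e = 1" "n \<bullet> n = 1" "n \<bullet> e = 0"
    using o by (auto simp: norm_eq_1 inner_commute)
  define \<sigma> where "\<sigma> = u q"
  have \<sigma>: "\<sigma> = 1 \<or> \<sigma> = -1" "\<sigma> * \<sigma> = 1" "\<bar>\<sigma>\<bar> = 1"
    using u_frontier[OF q] by (auto simp: \<sigma>_def)
  obtain \<rho>1 where \<rho>1: "\<rho>1 > 0" "\<And>x. dist x q < \<rho>1 \<Longrightarrow> \<bar>u x - u q\<bar> < 1"
    using isCont_u[of q] unfolding continuous_at_eps_delta dist_real_def
    by (metis zero_less_one)
  have near: "u x = \<sigma>" if "x \<notin> S" "dist x q < \<rho>1" for x
    using \<rho>1(2)[OF that(2)] outside[OF that(1)] \<sigma>(1) unfolding \<sigma>_def by auto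
  define r where "r = min (min \<rho> \<rho>1 / 2) (2 / c)"
  have r: "r > 0" "r < \<rho>" "r < \<rho>1" "c * r \<le> 2"
  proof -
    show "r > 0" "r < \<rho>" "r < \<rho>1" using \<rho> \<rho>1(1) c by (auto simp: r_def)
    have "c * r \<le> c * (2 / c)" using c by (intro mult_left_mono) (auto simp: r_def)
    then show "c * r \<le> 2" using c by simp
  qed
  define \<delta> where "\<delta> = c * r / 4"
  have \<delta>: "0 < \<delta>" "\<delta> \<le> 1/2" using r c by (auto simp: \<delta>_def)
  define X Y where "X x = (x - q) \<bullet> e" and "Y x = (x - q) \<bullet> n" for x
  \<comment> \<open>\<open>Q = - W\<close>, and \<open>h = v - W - 1\<close> below\<close>
  define Q where "Q x = - ((1 - \<delta>) * Y x) + (c/2) * (X x)\<^sup>2 - (c/4) * (Y x)\<^sup>2" for x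
  have nXY: "(norm (x - q))\<^sup>2 = (X x)\<^sup>2 + (Y x)\<^sup>2" for x
    unfolding X_def Y_def by (rule orthonormal_norm[OF o])
  have touch': "Y x \<ge> c * (X x)\<^sup>2" if x: "x \<in> closure S" "dist x q < \<rho>" for x
  proof -
    have "closed {x. c * (X x)\<^sup>2 \<le> Y x}"
      unfolding X_def Y_def by (intro closed_Collect_le continuous_intros)
    moreover have "ball q \<rho> \<inter> S \<subseteq> {x. c * (X x)\<^sup>2 \<le> Y x}"
      using touch by (auto simp: X_def Y_def intro: less_imp_le)
    moreover have "x \<in> closure (ball q \<rho> \<inter> S)"
      using open_Int_closure_subset[OF open_ball, of q \<rho> S] x by (auto simp: dist_commute)
    ultimately show ?thesis using closure_minimal by blast
  qed
  define h where "h x = (- \<sigma>) * u x + Q x" for x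
  have "compact (closure S \<inter> cball q r)" by (intro closed_Int_compact) auto
  moreover have "q \<in> closure S \<inter> cball q r" using q r frontier_S by auto
  moreover have "continuous_on (closure S \<inter> cball q r) h"
    unfolding h_def[abs_def] Q_def X_def Y_def by (intro continuous_intros)
  ultimately obtain z where "z \<in> closure S \<inter> cball q r" "\<And>y. y \<in> closure S \<inter> cball q r \<Longrightarrow> h y \<le> h z"
    using continuous_attains_sup[of "closure S \<inter> cball q r" h] by blast
  then have z: "z \<in> closure S" "dist z q \<le> r"
    and zmax: "\<And>y. y \<in> closure S \<Longrightarrow> dist y q \<le> r \<Longrightarrow> h y \<le> h z"
    by (auto simp: dist_commute)
  have hz: "h z \<le> -1"
  proof (cases "z \<in> S")
    case False
    have Yz: "Y z \<ge> c * (X z)\<^sup>2" using touch'[OF z(1)] z(2) r by simp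
    moreover have "0 \<le> c * (X z)\<^sup>2" using c by simp
    ultimately have Y0: "Y z \<ge> 0" by linarith
    have "\<delta> * Y z \<le> 1/2 * Y z" by (rule mult_right_mono[OF \<delta>(2) Y0])
    moreover have "(c/4) * (Y z)\<^sup>2 \<ge> 0" using c by simp
    ultimately have "Q z \<le> 0" using Yz unfolding Q_def by (simp add: algebra_simps)
    moreover have "u z = \<sigma>" using near[OF False] z(2) r by simp
    ultimately show ?thesis using \<sigma>(2) by (simp add: h_def)
  next
    case True
    show ?thesis
    proof (cases "dist z q = r")
      case sphere: True
      \<comment> \<open>the point on the parabola below \<open>z\<close>, which lies outside \<open>S\<close>\<close>
      define y where "y = q + (X z *\<^sub>R e + (c * (X z)\<^sup>2) *\<^sub>R n)"
      have Xy: "X y = X z" "Y y = c * (X z)\<^sup>2"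
        unfolding X_def[of y] Y_def[of y] using ee o(3) by (simp_all add: y_def inner_add_left)
      have Yz: "Y z > c * (X z)\<^sup>2"
        using touch[OF True] sphere r by (simp add: X_def Y_def dist_commute)
      have c0: "0 \<le> c * (X z)\<^sup>2" using c by simp
      have zy: "z - y = (Y z - c * (X z)\<^sup>2) *\<^sub>R n"
      proof -
        have "z - q = X z *\<^sub>R e + Y z *\<^sub>R n"
          unfolding X_def Y_def by (rule orthonormal_decomp[OF o, symmetric])
        then show ?thesis unfolding y_def by (simp add: algebra_simps)
      qed
      have "(norm (y - q))\<^sup>2 \<le> (norm (z - q))\<^sup>2"
        unfolding nXY Xy using Yz c0 by (intro add_left_mono power_mono) auto
      then have "dist y q \<le> r" using sphere by (metis dist_norm norm_ge_zero power2_le_imp_le)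
      then have yb: "dist y q < \<rho>" "dist y q < \<rho>1" using r by auto
      have "y \<notin> S"
        using touch[of y] yb Xy by (auto simp: X_def Y_def dist_commute)
      then have uy: "u y = \<sigma>" by (rule near) (rule yb)
      have "\<sigma> * (u y - u z) \<le> \<bar>u y - u z\<bar>"
        using \<sigma>(1) by auto
      also have "\<dots> \<le> norm (z - y)" using lipschitz[of y z] by (simp add: dist_norm norm_minus_commute)
      also have "\<dots> = Y z - c * (X z)\<^sup>2" using Yz o(2) by (simp add: zy)
      finally have v: "1 - \<sigma> * u z \<le> Y z - c * (X z)\<^sup>2"
        using \<sigma>(2) by (simp add: uy right_diff_distrib)
      have rr: "r\<^sup>2 = (X z)\<^sup>2 + (Y z)\<^sup>2" using nXY[of z] sphere by (simp add: dist_norm)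
      have "(Y z)\<^sup>2 \<le> r\<^sup>2" using rr by simp
      then have "Y z \<le> r" using r(1) by (rule power2_le_imp_le[OF _ less_imp_le])
      then have "\<delta> * Y z \<le> \<delta> * r" using \<delta> by (intro mult_left_mono) auto
      also have "\<dots> = (c/4) * (X z)\<^sup>2 + (c/4) * (Y z)\<^sup>2"
        using rr by (simp add: \<delta>_def power2_eq_square algebra_simps)
      finally have d: "\<delta> * Y z \<le> (c/4) * (X z)\<^sup>2 + (c/4) * (Y z)\<^sup>2" .
      have "(c/4) * (X z)\<^sup>2 \<ge> 0" using c by simp
      then show ?thesis
        unfolding h_def Q_def using v d by (simp add: algebra_simps)
    next
      case False
      then have zr: "z \<in> S \<inter> ball q r" using True z by (simp add: dist_commute)
      \<comment> \<open>the coefficients of \<open>Q\<close> on the coordinate lines; \<open>\<Sum> A i = c/2 - c/4 > 0\<close>\<close>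
      define A where "A i = (c/2) * (i \<bullet> e)\<^sup>2 - (c/4) * (i \<bullet> n)\<^sup>2" for i
      define B where "B i = - ((1 - \<delta>) * (i \<bullet> n)) + c * X z * (i \<bullet> e) - (c/2) * Y z * (i \<bullet> n)" for i
      have "\<exists>y\<in>S \<inter> ball q r. (- \<sigma>) * u y + Q y > (- \<sigma>) * u z + Q z"
      proof (rule no_local_max_of_pos_laplacian[where A = A and B = B])
        show "open (S \<inter> ball q r)" using open_S by auto
        show "Q (z + t *\<^sub>R i) = Q z + B i * t + A i * t\<^sup>2" for i t
        proof -
          have "X (z + t *\<^sub>R i) = X z + t * (i \<bullet> e)" "Y (z + t *\<^sub>R i) = Y z + t * (i \<bullet> n)"
            by (simp_all add: X_def Y_def inner_diff_left inner_add_left)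
          then show ?thesis
            by (simp add: Q_def A_def B_def power2_eq_square algebra_simps add_divide_distrib)
        qed
        have "(\<Sum>i\<in>Basis. A i) = c/2 * (\<Sum>i\<in>Basis. (i \<bullet> e)\<^sup>2) - c/4 * (\<Sum>i\<in>Basis. (i \<bullet> n)\<^sup>2)"
          by (simp add: A_def sum_subtractf sum_distrib_left)
        also have "\<dots> = c/4" by (simp add: sum_inner_Basis_sq o)
        finally show "(- \<sigma>) * laplacian u z + 2 * (\<Sum>i\<in>Basis. A i) > 0"
          using harmonic[OF True] c by simp
      qed (use zr diff1 diff2 in auto)
      then obtain y where y: "y \<in> S" "dist y q \<le> r" "h y > h z"
        by (auto simp: h_def dist_commute)
      then show ?thesis using zmax[of y] closure_subset[of S] by force
    qed
  qed
  have Gn1: "\<sigma> * (G q \<bullet> n) = -1"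
    unfolding \<sigma>_def by (rule boundary_gradient_normal[OF q o(2) inward])
  obtain t0 where t0: "t0 > 0" "\<forall>t. 0 < t \<and> t < t0 \<longrightarrow> q + t *\<^sub>R n \<in> S"
    using inward[of n] ee by auto
  have "(- \<sigma>) * (G q \<bullet> n) \<le> 1 - \<delta>"
  proof (rule boundary_slope_le[OF q, where K = "c/4"])
    show "min t0 r > 0" using t0 r by simp
    fix t assume t: "0 < t" "t < min t0 r"
    then show inS: "q + t *\<^sub>R n \<in> S" using t0 by simp
    have "h (q + t *\<^sub>R n) \<le> h z"
      using zmax[of "q + t *\<^sub>R n"] inS closure_subset[of S] t o by (auto simp: dist_norm)
    then have "(- \<sigma>) * u (q + t *\<^sub>R n) + Q (q + t *\<^sub>R n) \<le> -1" using hz by (simp add: h_def)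
    moreover have "Q (q + t *\<^sub>R n) = - ((1 - \<delta>) * t) - (c/4) * t\<^sup>2"
      by (simp add: Q_def X_def Y_def ee)
    ultimately show "(- \<sigma>) * (u (q + t *\<^sub>R n) - u q) \<le> (1 - \<delta>) * t + (c/4) * t\<^sup>2"
      using \<sigma>(2) unfolding \<sigma>_def[symmetric] by (simp add: right_diff_distrib)
  qed
  then show False using Gn1 \<delta> by simp
qed

end

section \<open>The complement is locally convex\<close>

text \<open>
  A parabola whose axis is not normal to its tangent at a point still contains, near that point, a
  parabola with normal axis and a quarter of the curvature.
\<close>

lemma parabola_in_tangent_frame:
  fixes B X Y \<epsilon> \<rho> :: real
  assumes \<epsilon>: "\<epsilon> > 0" and touch: "Y > \<epsilon> * (X - B * Y)\<^sup>2"
    and Y: "Y \<le> \<rho>" and small: "\<epsilon> * B\<^sup>2 * \<rho> \<le> 1"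
  shows "Y > \<epsilon> / 4 * X\<^sup>2"
proof -
  have "0 \<le> \<epsilon> * (X - B * Y)\<^sup>2" using \<epsilon> by simp
  then have Y0: "Y > 0" using touch by linarith
  have "0 \<le> (X - 2 * B * Y)\<^sup>2" by simp
  then have "X\<^sup>2 \<le> 2 * (X - B * Y)\<^sup>2 + 2 * (B\<^sup>2 * Y\<^sup>2)"
    by (simp add: power2_eq_square algebra_simps)
  then have "\<epsilon> * X\<^sup>2 \<le> \<epsilon> * (2 * (X - B * Y)\<^sup>2 + 2 * (B\<^sup>2 * Y\<^sup>2))" using \<epsilon> by (intro mult_left_mono) auto
  moreover have "\<epsilon> * (B\<^sup>2 * Y\<^sup>2) \<le> Y"
  proof -
    have "\<epsilon> * B\<^sup>2 * Y \<le> \<epsilon> * B\<^sup>2 * \<rho>" using Y \<epsilon> by (intro mult_left_mono) auto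
    then have "\<epsilon> * B\<^sup>2 * Y \<le> 1" using small by linarith
    then have "\<epsilon> * B\<^sup>2 * Y * Y \<le> 1 * Y" using Y0 by (intro mult_right_mono) auto
    then show ?thesis by (simp add: power2_eq_square mult.assoc)
  qed
  ultimately show ?thesis using touch by (simp add: algebra_simps)
qed

text \<open>
  Where a graph dips below one of its chords, subtract a small multiple of a square from the
  difference to the chord and minimise: the minimum is interior, and there a parabola touches the
  graph from below.
\<close>

lemma touching_parabola_of_chord:
  fixes \<gamma> :: "real \<Rightarrow> real"
  assumes cont: "continuous_on UNIV \<gamma>" and ab: "a < b" and m: "a < m" "m < b"
    and ends: "A + M * a \<le> \<gamma> a" "A + M * b \<le> \<gamma> b" and mid: "\<gamma> m < A + M * m"
  obtains t1 B \<epsilon> where "a < t1" "t1 < b" "\<epsilon> > 0"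
    "\<And>t. a \<le> t \<Longrightarrow> t \<le> b \<Longrightarrow> \<gamma> t \<ge> \<gamma> t1 + B * (t - t1) + \<epsilon> * (t - t1)\<^sup>2"
proof -
  define \<eta> where "\<eta> = A + M * m - \<gamma> m"
  \<comment> \<open>small enough that \<open>\<phi>\<close> stays above its value at \<open>m\<close> at both ends of the interval\<close>
  define \<epsilon> where "\<epsilon> = \<eta> / (2 * (b - a)\<^sup>2)"
  have \<eta>: "\<eta> > 0" using mid by (simp add: \<eta>_def)
  have \<epsilon>: "\<epsilon> > 0" using \<eta> ab by (simp add: \<epsilon>_def)
  define \<phi> where "\<phi> t = \<gamma> t - (A + M * t) - \<epsilon> * (t - m)\<^sup>2" for t
  have "continuous_on {a..b} \<phi>"
    unfolding \<phi>_def by (intro continuous_intros continuous_on_subset[OF cont]) auto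
  then obtain t1 where t1: "t1 \<in> {a..b}" "\<And>t. t \<in> {a..b} \<Longrightarrow> \<phi> t1 \<le> \<phi> t"
    using continuous_attains_inf[of "{a..b}" \<phi>] ab by auto
  have m1: "\<phi> t1 \<le> - \<eta>" using t1(2)[of m] m by (simp add: \<phi>_def \<eta>_def)
  have small: "\<epsilon> * (t - m)\<^sup>2 \<le> \<eta> / 2" if "t \<in> {a..b}" for t
  proof -
    have "\<bar>t - m\<bar> \<le> b - a" using that m by auto
    then have "(t - m)\<^sup>2 \<le> (b - a)\<^sup>2" by (metis abs_ge_zero power2_abs power_mono)
    then have "\<epsilon> * (t - m)\<^sup>2 \<le> \<epsilon> * (b - a)\<^sup>2" using \<epsilon> by (intro mult_left_mono) auto
    then show ?thesis using ab by (simp add: \<epsilon>_def)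
  qed
  have "\<phi> a \<ge> - (\<eta> / 2)" "\<phi> b \<ge> - (\<eta> / 2)"
    using ends small[of a] small[of b] ab by (auto simp: \<phi>_def)
  then have "t1 \<noteq> a" "t1 \<noteq> b" using m1 \<eta> by auto
  then have in1: "a < t1" "t1 < b" using t1(1) by auto
  show ?thesis
  proof (rule that[OF in1 \<epsilon>])
    fix t assume "a \<le> t" "t \<le> b"
    then have "\<phi> t1 \<le> \<phi> t" using t1(2) by simp
    then show "\<gamma> t \<ge> \<gamma> t1 + (M + 2 * \<epsilon> * (t1 - m)) * (t - t1) + \<epsilon> * (t - t1)\<^sup>2"
      by (simp add: \<phi>_def power2_eq_square algebra_simps)
  qed
qed

context free_boundary_solution
begin

text \<open>
  Passes from the coordinates of the graph to the orthonormal frame given by the tangent and the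
  normal of the graph at the touching point, where the barrier argument applies.
\<close>

lemma no_parabola_below_graph:
  assumes g: "norm \<tau> = 1" "norm \<nu> = 1" "\<tau> \<bullet> \<nu> = 0"
    "\<And>t. \<gamma> differentiable (at (t::real))" "\<And>x. x \<in> ball p r \<Longrightarrow> x \<in> S \<longleftrightarrow> \<gamma> (x \<bullet> \<tau>) < x \<bullet> \<nu>"
    and q: "q \<in> ball p r" "q \<bullet> \<nu> = \<gamma> (q \<bullet> \<tau>)"
    and d: "d > 0" and \<epsilon>: "\<epsilon> > 0"
    and below: "\<And>t. \<bar>t - q \<bullet> \<tau>\<bar> < d \<Longrightarrow> \<gamma> t \<ge> \<gamma> (q \<bullet> \<tau>) + B * (t - q \<bullet> \<tau>) + \<epsilon> * (t - q \<bullet> \<tau>)\<^sup>2"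
  shows False
proof -
  define t1 where "t1 = q \<bullet> \<tau>"
  obtain D where D: "(\<gamma> has_real_derivative D) (at t1)"
    using g(4) real_differentiableE by blast
  have "((\<lambda>t. \<gamma> t - B * (t - t1)) has_real_derivative D - B) (at t1)"
    by (auto intro!: derivative_eq_intros D)
  then have "D - B = 0"
  proof (rule DERIV_local_min[OF _ d])
    show "\<forall>y. \<bar>t1 - y\<bar> < d \<longrightarrow> \<gamma> t1 - B * (t1 - t1) \<le> \<gamma> y - B * (y - t1)"
    proof (intro allI impI)
      fix y assume "\<bar>t1 - y\<bar> < d"
      then have "\<gamma> y \<ge> \<gamma> t1 + B * (y - t1) + \<epsilon> * (y - t1)\<^sup>2"
        using below[of y] by (simp add: t1_def abs_minus_commute)
      moreover have "\<epsilon> * (y - t1)\<^sup>2 \<ge> 0" using \<epsilon> by simp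
      ultimately show "\<gamma> t1 - B * (t1 - t1) \<le> \<gamma> y - B * (y - t1)" by simp
    qed
  qed
  then have D': "(\<gamma> has_real_derivative B) (at t1)" using D by simp
  obtain s where s: "s > 0" "ball q s \<subseteq> ball p r"
    using openE[OF open_ball q(1)] by blast
  have inward: "\<exists>t0>0. \<forall>t. 0 < t \<and> t < t0 \<longrightarrow> q + t *\<^sub>R \<xi> \<in> S" if \<xi>: "\<xi> \<bullet> \<nu> - B * (\<xi> \<bullet> \<tau>) > 0" for \<xi>
  proof -
    have "((\<lambda>t. t1 + t * (\<xi> \<bullet> \<tau>)) has_real_derivative \<xi> \<bullet> \<tau>) (at 0)"
      by (auto intro!: derivative_eq_intros)
    moreover have "(\<gamma> has_real_derivative B) (at (t1 + 0 * (\<xi> \<bullet> \<tau>)))" using D' by simp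
    ultimately have "((\<lambda>t. \<gamma> (t1 + t * (\<xi> \<bullet> \<tau>))) has_real_derivative B * (\<xi> \<bullet> \<tau>)) (at 0)"
      by (rule DERIV_chain2[rotated])
    then have "((\<lambda>t. t * (\<xi> \<bullet> \<nu>) - \<gamma> (t1 + t * (\<xi> \<bullet> \<tau>))) has_real_derivative \<xi> \<bullet> \<nu> - B * (\<xi> \<bullet> \<tau>)) (at 0)"
      by (auto intro!: derivative_eq_intros)
    from DERIV_pos_inc_right[OF this \<xi>] obtain d1 where d1: "d1 > 0"
      "\<And>t. 0 < t \<Longrightarrow> t < d1 \<Longrightarrow> - \<gamma> t1 < t * (\<xi> \<bullet> \<nu>) - \<gamma> (t1 + t * (\<xi> \<bullet> \<tau>))" by auto
    define t0 where "t0 = min d1 (s / (norm \<xi> + 1))"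
    have "t0 > 0" using d1(1) s(1) by (simp add: t0_def add_nonneg_pos)
    moreover have "q + t *\<^sub>R \<xi> \<in> S" if t: "0 < t" "t < t0" for t
    proof -
      have "t * norm \<xi> \<le> t * (norm \<xi> + 1)" using t by (intro mult_left_mono) auto
      also have "\<dots> < s" using t by (simp add: t0_def pos_less_divide_eq add_nonneg_pos)
      finally have "q + t *\<^sub>R \<xi> \<in> ball p r" using s(2) t(1) by (auto simp: dist_norm subset_iff)
      moreover have "\<gamma> (t1 + t * (\<xi> \<bullet> \<tau>)) < \<gamma> t1 + t * (\<xi> \<bullet> \<nu>)"
        using d1(2)[of t] t by (simp add: t0_def)
      ultimately show ?thesis
        using g(5)[of "q + t *\<^sub>R \<xi>"] q(2) by (simp add: inner_add_left t1_def)
    qed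
    ultimately show ?thesis by blast
  qed
  have \<nu>\<nu>: "\<nu> \<bullet> \<nu> = 1" "\<tau> \<bullet> \<tau> = 1" "\<nu> \<bullet> \<tau> = 0" using g by (auto simp: norm_eq_1 inner_commute)
  have qf: "q \<in> frontier S"
  proof -
    have "q \<notin> S" using g(5)[OF q(1)] q(2) by simp
    moreover have "q \<in> closure S"
      unfolding closure_approachable
    proof (intro allI impI)
      fix e :: real assume e: "e > 0"
      obtain t0 where t0: "t0 > 0" "\<forall>t. 0 < t \<and> t < t0 \<longrightarrow> q + t *\<^sub>R \<nu> \<in> S"
        using inward[of \<nu>] \<nu>\<nu> by auto
      define t where "t = min t0 e / 2"
      have "0 < t" "t < t0" "t < e" using t0(1) e by (auto simp: t_def)
      then show "\<exists>y\<in>S. dist y q < e"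
        using t0(2) g(2) by (intro bexI[of _ "q + t *\<^sub>R \<nu>"]) (auto simp: dist_norm)
    qed
    ultimately show ?thesis by (simp add: frontier_S)
  qed
  define \<kappa> where "\<kappa> = sqrt (1 + B\<^sup>2)"
  have \<kappa>: "\<kappa> > 0" "\<kappa> * \<kappa> = 1 + B * B"
    by (simp_all add: \<kappa>_def add_pos_nonneg power2_eq_square)
  define n where "n = (\<nu> - B *\<^sub>R \<tau>) /\<^sub>R \<kappa>"
  define e where "e = (\<tau> + B *\<^sub>R \<nu>) /\<^sub>R \<kappa>"
  have o: "norm e = 1" "norm n = 1" "e \<bullet> n = 0"
  proof -
    have "(\<tau> + B *\<^sub>R \<nu>) \<bullet> (\<tau> + B *\<^sub>R \<nu>) = \<kappa> * \<kappa>" "(\<nu> - B *\<^sub>R \<tau>) \<bullet> (\<nu> - B *\<^sub>R \<tau>) = \<kappa> * \<kappa>"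
      using \<nu>\<nu> g(3) by (simp_all add: \<kappa>(2) inner_add_left inner_add_right inner_diff_left inner_diff_right)
    then have "norm (\<tau> + B *\<^sub>R \<nu>) = \<kappa>" "norm (\<nu> - B *\<^sub>R \<tau>) = \<kappa>"
      using \<kappa>(1) by (simp_all add: norm_eq_sqrt_inner)
    then show "norm e = 1" "norm n = 1"
      using \<kappa>(1) by (simp_all add: e_def n_def)
    show "e \<bullet> n = 0"
      using \<nu>\<nu> g(3) by (simp add: e_def n_def inner_add_left inner_add_right inner_diff_left inner_diff_right)
  qed
  \<comment> \<open>one factor \<open>\<kappa>\<close> comes from \<open>n\<close> and two from the square of the tangential coordinate\<close>
  define \<epsilon>' where "\<epsilon>' = \<epsilon> / \<kappa> ^ 3"
  have \<epsilon>': "\<epsilon>' > 0" using \<epsilon> \<kappa>(1) by (simp add: \<epsilon>'_def)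
  define K where "K = \<epsilon>' * (B\<^sup>2 + 1)"
  have K: "K > 0" unfolding K_def using \<epsilon>' by (intro mult_pos_pos add_nonneg_pos) auto
  define \<rho> where "\<rho> = min (min s d) (1 / K)"
  have \<rho>: "\<rho> > 0" "\<rho> \<le> s" "\<rho> \<le> d" "\<epsilon>' * B\<^sup>2 * \<rho> \<le> 1"
  proof -
    show *: "\<rho> > 0" "\<rho> \<le> s" "\<rho> \<le> d" using K s(1) d by (auto simp: \<rho>_def)
    have "\<epsilon>' * B\<^sup>2 * \<rho> \<le> K * \<rho>"
      unfolding K_def using \<epsilon>' *(1) by (intro mult_right_mono mult_left_mono) auto
    also have "\<dots> \<le> K * (1 / K)"
      using K by (intro mult_left_mono) (auto simp: \<rho>_def)
    also have "\<dots> = 1" using K by simp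
    finally show "\<epsilon>' * B\<^sup>2 * \<rho> \<le> 1" .
  qed
  show False
  proof (rule no_touching_parabola[OF qf o _ \<rho>(1), of "\<epsilon>' / 4"])
    show "\<epsilon>' / 4 > 0" using \<epsilon>' by simp
    show "\<exists>t0>0. \<forall>t. 0 < t \<and> t < t0 \<longrightarrow> q + t *\<^sub>R \<xi> \<in> S" if "\<xi> \<bullet> n > 0" for \<xi>
    proof (rule inward)
      have "\<kappa> * (\<xi> \<bullet> n) = \<xi> \<bullet> \<nu> - B * (\<xi> \<bullet> \<tau>)"
        using \<kappa>(1) by (simp add: n_def inner_diff_right)
      then show "\<xi> \<bullet> \<nu> - B * (\<xi> \<bullet> \<tau>) > 0" using mult_pos_pos[OF \<kappa>(1) that] by simp
    qed
    fix x assume x: "x \<in> S" "x \<in> ball q \<rho>"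
    define a b where "a = (x - q) \<bullet> \<tau>" and "b = (x - q) \<bullet> \<nu>"
    define X Y where "X = (x - q) \<bullet> e" and "Y = (x - q) \<bullet> n"
    have nx: "norm (x - q) < \<rho>" using x(2) by (simp add: dist_norm norm_minus_commute)
    have kY: "\<kappa> * Y = b - B * a" and kX: "\<kappa> * X = a + B * b"
      using \<kappa>(1) by (simp_all add: X_def Y_def a_def b_def n_def e_def inner_diff_right inner_add_right)
    have "\<kappa> * (X - B * Y) = \<kappa> * X - B * (\<kappa> * Y)" by (simp add: algebra_simps)
    also have "\<dots> = a + B * b - B * (b - B * a)" by (simp only: kX kY)
    also have "\<dots> = (1 + B * B) * a" by (simp add: algebra_simps)
    also have "\<dots> = \<kappa> * (\<kappa> * a)" by (simp only: \<kappa>(2)[symmetric] mult.assoc)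
    finally have "\<kappa> * (X - B * Y) = \<kappa> * (\<kappa> * a)" .
    then have ka: "\<kappa> * a = X - B * Y" using \<kappa>(1) by auto
    have "\<bar>a\<bar> \<le> norm (x - q) * norm \<tau>" "\<bar>Y\<bar> \<le> norm (x - q) * norm n"
      unfolding a_def Y_def by (rule Cauchy_Schwarz_ineq2)+
    then have an: "\<bar>a\<bar> < d" "Y \<le> \<rho>" using nx \<rho>(3) g(1) o(2) by auto
    have xp: "x \<in> ball p r" using x(2) subset_ball[OF \<rho>(2), of q] s(2) by blast
    have xt: "x \<bullet> \<tau> = t1 + a" "x \<bullet> \<nu> = \<gamma> t1 + b"
      using q(2) by (simp_all add: a_def b_def t1_def inner_diff_left)
    have "\<gamma> t1 + B * a + \<epsilon> * a\<^sup>2 \<le> \<gamma> (t1 + a)"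
      using below[of "t1 + a"] an(1) by (simp add: t1_def)
    also have "\<dots> < \<gamma> t1 + b" using g(5)[OF xp] x(1) xt by simp
    finally have "\<kappa> * Y > \<epsilon> * a\<^sup>2" using kY by simp
    then have "Y > \<epsilon> * a\<^sup>2 / \<kappa>" using \<kappa>(1) by (simp add: pos_divide_less_eq mult.commute)
    also have "\<epsilon> * a\<^sup>2 / \<kappa> = \<epsilon>' * (X - B * Y)\<^sup>2"
      unfolding ka[symmetric] \<epsilon>'_def using \<kappa>(1) by (simp add: power2_eq_square power3_eq_cube)
    finally show "\<epsilon>' / 4 * ((x - q) \<bullet> e)\<^sup>2 < (x - q) \<bullet> n"
      using parabola_in_tangent_frame[OF \<epsilon>' _ an(2) \<rho>(4)] by (simp add: X_def Y_def)
  qed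
qed

text \<open>
  Near \<open>p\<close> the complement of \<open>S\<close> is the region below a graph. If it were not convex, the graph would
  dip below a chord and thus be touched by a parabola from below.
\<close>

lemma complement_locally_convex_frontier:
  assumes p: "p \<in> frontier S"
  shows "\<exists>r>0. convex (- S \<inter> ball p r)"
proof -
  obtain r \<tau> \<nu> \<gamma> where g: "r > 0" "norm \<tau> = 1" "norm \<nu> = 1" "\<tau> \<bullet> \<nu> = 0"
    "\<And>t. \<gamma> differentiable (at (t::real))" "\<And>x. x \<in> ball p r \<Longrightarrow> x \<in> S \<longleftrightarrow> \<gamma> (x \<bullet> \<tau>) < x \<bullet> \<nu>"
    "\<gamma> (p \<bullet> \<tau>) = p \<bullet> \<nu>"
    using graph_at_frontier[OF p] by metis
  have cont: "continuous_on UNIV \<gamma>"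
    by (intro differentiable_imp_continuous_on) (simp add: differentiable_on_def g(5))
  define t0 where "t0 = p \<bullet> \<tau>"
  have "isCont \<gamma> t0" using cont by (simp add: continuous_on_eq_continuous_at)
  then obtain \<eta> where \<eta>: "\<eta> > 0" "\<And>t. dist t t0 < \<eta> \<Longrightarrow> dist (\<gamma> t) (\<gamma> t0) < r/2"
    using g(1) unfolding continuous_at_eps_delta by (metis half_gt_zero)
  \<comment> \<open>small enough that the graph over the shadow of \<open>ball p r1\<close> stays in \<open>ball p r\<close>\<close>
  define r1 where "r1 = min \<eta> (r/2)"
  have r1: "r1 > 0" "r1 \<le> \<eta>" "r1 \<le> r/2" using \<eta>(1) g(1) by (auto simp: r1_def)
  have \<nu>\<nu>: "\<nu> \<bullet> \<nu> = 1" "\<tau> \<bullet> \<tau> = 1" "\<nu> \<bullet> \<tau> = 0" using g by (auto simp: norm_eq_1 inner_commute)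
  define P where "P t = t *\<^sub>R \<tau> + \<gamma> t *\<^sub>R \<nu>" for t
  have P: "P t \<bullet> \<tau> = t" "P t \<bullet> \<nu> = \<gamma> t" for t
    using \<nu>\<nu> g(4) by (simp_all add: P_def inner_add_left)
  have Pb: "P t \<in> ball p r" if "\<bar>t - t0\<bar> < r1" for t
  proof -
    have "\<bar>t - t0\<bar> < r/2" "\<bar>\<gamma> t - \<gamma> t0\<bar> < r/2"
      using that r1 \<eta>(2)[of t] by (auto simp: dist_real_def)
    then have "(t - t0)\<^sup>2 < (r/2)\<^sup>2" "(\<gamma> t - \<gamma> t0)\<^sup>2 < (r/2)\<^sup>2"
      by (metis abs_ge_zero power2_abs power_strict_mono zero_less_numeral)+
    moreover have "(norm (P t - p))\<^sup>2 = (t - t0)\<^sup>2 + (\<gamma> t - \<gamma> t0)\<^sup>2"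
      using orthonormal_norm[OF g(2-4), of "P t - p"] by (simp add: inner_diff_left P t0_def g(7))
    moreover have "(r/2)\<^sup>2 + (r/2)\<^sup>2 \<le> r\<^sup>2" by (simp add: power2_eq_square)
    ultimately have "(norm (P t - p))\<^sup>2 < r\<^sup>2" by linarith
    then have "norm (P t - p) < r" using g(1) by (metis less_imp_le power_less_imp_less_base)
    then show ?thesis by (simp add: dist_norm norm_minus_commute)
  qed
  have sub: "ball p r1 \<subseteq> ball p r" using r1 g(1) by auto
  have coord: "\<bar>x \<bullet> \<tau> - t0\<bar> < r1" if "x \<in> ball p r1" for x
  proof -
    have "\<bar>(x - p) \<bullet> \<tau>\<bar> \<le> norm (x - p) * norm \<tau>" by (rule Cauchy_Schwarz_ineq2)
    then show ?thesis using that g(2) by (simp add: dist_norm norm_minus_commute inner_diff_left t0_def)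
  qed
  have key: False
    if a: "a \<in> - S \<inter> ball p r1" and b: "b \<in> - S \<inter> ball p r1" and lt: "a \<bullet> \<tau> < b \<bullet> \<tau>"
      and l: "0 \<le> l" "l \<le> 1" and m: "(1 - l) *\<^sub>R a + l *\<^sub>R b \<in> S" for a b l
  proof -
    define ta tb where "ta = a \<bullet> \<tau>" and "tb = b \<bullet> \<tau>"
    define M where "M = (b \<bullet> \<nu> - a \<bullet> \<nu>) / (tb - ta)"
    define A where "A = a \<bullet> \<nu> - M * ta"
    define x where "x = (1 - l) *\<^sub>R a + l *\<^sub>R b"
    have tt: "ta < tb" using lt by (simp add: ta_def tb_def)
    have M: "M * (tb - ta) = b \<bullet> \<nu> - a \<bullet> \<nu>" using tt by (simp add: M_def)
    have xb: "x \<in> ball p r1"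
      unfolding x_def using a b l by (intro convexD_alt[OF convex_ball]) auto
    have "A + M * ta = a \<bullet> \<nu>" by (simp add: A_def)
    then have ea: "A + M * ta \<le> \<gamma> ta"
      using a g(6)[of a] sub by (auto simp: ta_def)
    have "A + M * tb = b \<bullet> \<nu>" using M by (simp add: A_def algebra_simps)
    then have eb: "A + M * tb \<le> \<gamma> tb"
      using b g(6)[of b] sub by (auto simp: tb_def)
    have xt: "x \<bullet> \<tau> = ta + l * (tb - ta)"
      by (simp add: x_def inner_add_left ta_def tb_def algebra_simps)
    have "x \<bullet> \<nu> = a \<bullet> \<nu> + l * (M * (tb - ta))"
      unfolding M by (simp add: x_def inner_add_left algebra_simps)
    also have "\<dots> = A + M * (x \<bullet> \<tau>)" unfolding xt by (simp add: A_def algebra_simps)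
    finally have mid: "\<gamma> (x \<bullet> \<tau>) < A + M * (x \<bullet> \<tau>)"
      using m g(6)[of x] xb sub by (auto simp: x_def[symmetric])
    have "0 \<le> l * (tb - ta)" "l * (tb - ta) \<le> 1 * (tb - ta)"
      using l tt by (auto intro!: mult_right_mono)
    then have "ta \<le> x \<bullet> \<tau>" "x \<bullet> \<tau> \<le> tb" unfolding xt by auto
    moreover have "x \<bullet> \<tau> \<noteq> ta" "x \<bullet> \<tau> \<noteq> tb" using mid ea eb by auto
    ultimately have xin: "ta < x \<bullet> \<tau>" "x \<bullet> \<tau> < tb" by auto
    obtain t1 B \<epsilon> where t1: "ta < t1" "t1 < tb" "\<epsilon> > 0"
      "\<And>t. ta \<le> t \<Longrightarrow> t \<le> tb \<Longrightarrow> \<gamma> t \<ge> \<gamma> t1 + B * (t - t1) + \<epsilon> * (t - t1)\<^sup>2"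
      using touching_parabola_of_chord[OF cont tt xin ea eb mid] by metis
    have "\<bar>t1 - t0\<bar> < r1"
      using coord[of a] coord[of b] a b t1(1,2) unfolding ta_def tb_def by auto
    then have q: "P t1 \<in> ball p r" by (rule Pb)
    show False
    proof (rule no_parabola_below_graph[OF g(2-6) q, where d = "min (t1 - ta) (tb - t1)"])
      show "P t1 \<bullet> \<nu> = \<gamma> (P t1 \<bullet> \<tau>)" by (simp add: P)
      show "0 < min (t1 - ta) (tb - t1)" using t1 by simp
      show "\<epsilon> > 0" by (rule t1)
      show "\<gamma> (P t1 \<bullet> \<tau>) + B * (t - P t1 \<bullet> \<tau>) + \<epsilon> * (t - P t1 \<bullet> \<tau>)\<^sup>2 \<le> \<gamma> t"
        if "\<bar>t - P t1 \<bullet> \<tau>\<bar> < min (t1 - ta) (tb - t1)" for t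
        unfolding P using that by (intro t1(4)) (auto simp: P abs_less_iff)
    qed
  qed
  have "convex (- S \<inter> ball p r1)"
    unfolding convex_alt
  proof (intro ballI allI impI)
    fix a b l assume a: "a \<in> - S \<inter> ball p r1" and b: "b \<in> - S \<inter> ball p r1" and l: "0 \<le> l \<and> l \<le> (1::real)"
    define x where "x = (1 - l) *\<^sub>R a + l *\<^sub>R b"
    have xb: "x \<in> ball p r1"
      unfolding x_def using a b l by (intro convexD_alt[OF convex_ball]) auto
    have "x \<notin> S"
    proof
      assume xS: "x \<in> S"
      consider "a \<bullet> \<tau> < b \<bullet> \<tau>" | "b \<bullet> \<tau> < a \<bullet> \<tau>" | "a \<bullet> \<tau> = b \<bullet> \<tau>" by linarith
      then show False
      proof cases
        case 1 then show ?thesis using key[OF a b] l xS by (auto simp: x_def)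
      next
        case 2
        have "(1 - (1 - l)) *\<^sub>R b + (1 - l) *\<^sub>R a \<in> S" using xS by (simp add: x_def add.commute)
        then show ?thesis using key[OF b a 2, of "1 - l"] l by auto
      next
        case 3
        have "x \<bullet> \<tau> = a \<bullet> \<tau>" by (simp add: x_def inner_add_left 3[symmetric] algebra_simps)
        then have "\<gamma> (a \<bullet> \<tau>) < (1 - l) * (a \<bullet> \<nu>) + l * (b \<bullet> \<nu>)"
          using g(6)[of x] xS xb sub by (auto simp: x_def inner_add_left)
        moreover have "a \<bullet> \<nu> \<le> \<gamma> (a \<bullet> \<tau>)" "b \<bullet> \<nu> \<le> \<gamma> (a \<bullet> \<tau>)"
          using g(6)[of a] g(6)[of b] a b sub 3 by (auto simp: not_less[symmetric])
        then have "(1 - l) * (a \<bullet> \<nu>) + l * (b \<bullet> \<nu>) \<le> (1 - l) * \<gamma> (a \<bullet> \<tau>) + l * \<gamma> (a \<bullet> \<tau>)"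
          using l by (intro add_mono mult_left_mono) auto
        ultimately show ?thesis by (simp add: algebra_simps)
      qed
    qed
    then show "(1 - l) *\<^sub>R a + l *\<^sub>R b \<in> - S \<inter> ball p r1" using xb by (simp add: x_def)
  qed
  then show ?thesis using r1(1) by blast
qed

end

section \<open>From a line in the complement to one-dimensionality\<close>

context free_boundary_solution
begin

lemma complement_locally_convex:
  assumes p: "p \<notin> S"
  shows "\<exists>r>0. convex (- S \<inter> ball p r)"
proof (cases "p \<in> closure S")
  case True
  then show ?thesis using complement_locally_convex_frontier p by (simp add: frontier_S)
next
  case False
  then obtain r where r: "r > 0" "ball p r \<subseteq> - closure S"
    using openE[of "- closure S" p] by auto
  then have "- S \<inter> ball p r = ball p r" using closure_subset by blast
  then show ?thesis using r(1) by (metis convex_ball)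
qed

lemma component_absorbs:
  assumes C: "C \<in> components (- S)" and p: "p \<in> C" and r: "r > 0" "convex (- S \<inter> ball p r)"
  shows "- S \<inter> ball p r \<subseteq> C"
proof (rule components_maximal[OF C convex_connected[OF r(2)]])
  have "p \<in> - S" using in_components_subset[OF C] p by blast
  then have "p \<in> C \<inter> (- S \<inter> ball p r)" using p r(1) by simp
  then show "C \<inter> (- S \<inter> ball p r) \<noteq> {}" by blast
qed blast

text \<open>
  Near each of its points a component agrees with the whole complement, so it inherits local
  convexity.
\<close>

lemma component_closed_convex:
  assumes C: "C \<in> components (- S)"
  shows "closed C" "convex C"
proof -
  show cl: "closed C" using closed_components[OF _ C] open_S by auto
  show "convex C"
  proof (rule Tietze_Nakajima[OF cl in_components_connected[OF C]])
    fix p assume p: "p \<in> C"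
    then have pS: "p \<notin> S" using in_components_subset[OF C] by blast
    obtain r where r: "r > 0" "convex (- S \<inter> ball p r)" using complement_locally_convex[OF pS] by blast
    have "C \<inter> ball p r = - S \<inter> ball p r"
      using component_absorbs[OF C p r] in_components_subset[OF C] by blast
    then show "\<exists>r>0. convex (C \<inter> ball p r)" using r by metis
  qed
qed

lemma connected_line: "connected {x :: real^2. x \<bullet> e = a}"
  using convex_hyperplane[of e a] by (intro convex_connected) (simp add: inner_commute)

text \<open>
  Outside \<open>S\<close> only the values \<open>1\<close> and \<open>-1\<close> occur.
\<close>

lemma constant_on_line:
  assumes "{x. x \<bullet> e = a} \<inter> S = {}" "x \<bullet> e = a" "y \<bullet> e = a"
  shows "u x = u y"
proof (rule ccontr)
  assume ne: "u x \<noteq> u y"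
  have "u x = 1 \<or> u x = -1" "u y = 1 \<or> u y = -1" using assms outside by blast+
  moreover have "connected (u ` {x. x \<bullet> e = a})"
    by (rule connected_continuous_image[OF continuous_on_subset[OF cont_u] connected_line]) simp
  then have "0 \<in> u ` {x. x \<bullet> e = a}"
    if "-1 \<in> u ` {x. x \<bullet> e = a}" "1 \<in> u ` {x. x \<bullet> e = a}"
    using connected_contains_Icc[OF _ that] by force
  ultimately have "0 \<in> u ` {x. x \<bullet> e = a}"
    using ne assms(2,3) by (smt (verit) imageI mem_Collect_eq)
  then show False using assms(1) by (auto simp: S_eq)
qed

text \<open>
  With \<open>\<sigma> = u p\<close>, the difference \<open>z = (x \<bullet> e - \<beta>) - (1 - \<sigma> u x)\<close> is nonnegative beyond the line by the
  Lipschitz bound, harmonic in \<open>S\<close>, and has vanishing normal derivative at \<open>p\<close>. Harnack's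
  inequality in a disc that touches the line at \<open>p\<close> makes \<open>z\<close> vanish at the centre of the disc. The
  zero set of \<open>z\<close> in the strip of width \<open>2\<close> is closed, it lies in \<open>S\<close>, and it is open again by
  Harnack's inequality; so it is the whole strip.
\<close>

lemma linear_beyond_flat_boundary:
  assumes e: "norm e = 1" and line: "{x. x \<bullet> e = \<beta>} \<inter> S = {}"
    and p: "p \<bullet> e = \<beta>" and r: "r > 0" and side: "\<And>x. x \<in> ball p r \<Longrightarrow> x \<bullet> e > \<beta> \<Longrightarrow> x \<in> S"
    and x: "\<beta> \<le> x \<bullet> e" "x \<bullet> e \<le> \<beta> + 2"
  shows "u x = u p * (1 - (x \<bullet> e - \<beta>))"
proof -
  have ee: "e \<bullet> e = 1" using e by (simp add: norm_eq_1)
  define \<sigma> where "\<sigma> = u p"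
  have pS: "p \<notin> S" using line p by blast
  have \<sigma>: "\<sigma> = 1 \<or> \<sigma> = -1" "\<sigma> * \<sigma> = 1" using outside[OF pS] by (auto simp: \<sigma>_def)
  define z where "z x = (- \<beta> - 1) + e \<bullet> x + \<sigma> * u x" for x
  have z0: "z x \<ge> 0" if "x \<bullet> e \<ge> \<beta>" for x
  proof -
    define y where "y = x - (x \<bullet> e - \<beta>) *\<^sub>R e"
    have "y \<bullet> e = \<beta>" by (simp add: y_def inner_diff_left ee)
    then have "u y = \<sigma>" using constant_on_line[OF line _ p] by (simp add: \<sigma>_def)
    moreover have "dist y x = x \<bullet> e - \<beta>" using that e by (simp add: y_def dist_norm)
    ultimately have "\<bar>\<sigma> - u x\<bar> \<le> x \<bullet> e - \<beta>" using lipschitz[of y x] by simp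
    then show ?thesis using \<sigma>(1) by (auto simp: z_def inner_commute[of e] abs_le_iff)
  qed
  define T where "T = {x. \<beta> < x \<bullet> e \<and> x \<bullet> e < \<beta> + 2}"
  have T: "open T" "connected T"
  proof -
    have "T = {x. \<beta> < x \<bullet> e} \<inter> {x. x \<bullet> e < \<beta> + 2}" by (auto simp: T_def)
    moreover have "open {x. \<beta> < x \<bullet> e}" "open {x. x \<bullet> e < \<beta> + 2}"
      by (intro open_Collect_less continuous_intros)+
    moreover have "convex {x. \<beta> < x \<bullet> e}" "convex {x. x \<bullet> e < \<beta> + 2}"
      using convex_halfspace_gt[of \<beta> e] convex_halfspace_lt[of e "\<beta> + 2"] by (simp_all add: inner_commute)
    ultimately show "open T" "connected T"
      by (auto intro: open_Int convex_connected convex_Int)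
  qed
  define Z where "Z = {x \<in> T. z x = 0}"
  have ZS: "x \<in> S" if "x \<in> Z" for x
    using that \<sigma>(1) by (auto simp: Z_def T_def z_def S_eq inner_commute[of e])
  have inward: "\<exists>t0>0. \<forall>t. 0 < t \<and> t < t0 \<longrightarrow> p + t *\<^sub>R \<xi> \<in> S" if "\<xi> \<bullet> e > 0" for \<xi>
  proof (intro exI[of _ "r / (norm \<xi> + 1)"] conjI allI impI)
    show "r / (norm \<xi> + 1) > 0" using r by (simp add: add_nonneg_pos)
    fix t assume t: "0 < t \<and> t < r / (norm \<xi> + 1)"
    have "t * norm \<xi> \<le> t * (norm \<xi> + 1)" using t by (intro mult_left_mono) auto
    also have "\<dots> < r" using t by (simp add: pos_less_divide_eq add_nonneg_pos)
    finally show "p + t *\<^sub>R \<xi> \<in> S"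
      using t that by (intro side) (auto simp: dist_norm inner_add_left p)
  qed
  have pf: "p \<in> frontier S"
  proof -
    have "p \<in> closure S"
      unfolding closure_approachable
    proof (intro allI impI)
      fix \<epsilon> :: real assume \<epsilon>: "\<epsilon> > 0"
      obtain t0 where t0: "t0 > 0" "\<forall>t. 0 < t \<and> t < t0 \<longrightarrow> p + t *\<^sub>R e \<in> S"
        using inward[of e] ee by auto
      define t where "t = min t0 \<epsilon> / 2"
      have "0 < t" "t < t0" "t < \<epsilon>" using t0(1) \<epsilon> by (auto simp: t_def)
      then show "\<exists>y\<in>S. dist y p < \<epsilon>"
        using t0(2) e by (intro bexI[of _ "p + t *\<^sub>R e"]) (auto simp: dist_norm)
    qed
    then show ?thesis using pS by (simp add: frontier_S)
  qed
  have Ge: "\<sigma> * (G p \<bullet> e) = -1"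
    unfolding \<sigma>_def by (rule boundary_gradient_normal[OF pf e inward])
  have "Z \<noteq> {}"
  proof -
    \<comment> \<open>the disc of radius \<open>d\<close> around \<open>x0\<close> touches the line at \<open>p\<close> and lies in \<open>S\<close>\<close>
    define d where "d = min r 1 / 3"
    have d: "d > 0" "2 * d < r" "d < 2" using r by (auto simp: d_def)
    define x0 where "x0 = p + d *\<^sub>R e"
    have above: "y \<bullet> e > \<beta>" if "y \<in> ball x0 d" for y
    proof -
      have "\<bar>(y - x0) \<bullet> e\<bar> \<le> norm (y - x0) * norm e" by (rule Cauchy_Schwarz_ineq2)
      also have "\<dots> < d" using that e by (simp add: dist_norm norm_minus_commute)
      finally show ?thesis by (simp add: x0_def inner_diff_left inner_add_left p ee)
    qed
    have sub: "ball x0 d \<subseteq> S"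
    proof
      fix y assume y: "y \<in> ball x0 d"
      have "dist p y \<le> dist p x0 + dist x0 y" by (rule dist_triangle)
      also have "\<dots> < r" using y d e by (simp add: x0_def dist_norm)
      finally show "y \<in> S" using side above[OF y] by simp
    qed
    have "(- \<sigma>) * (G p \<bullet> e) \<le> 1 - z x0 / (2 * d)"
    proof (rule boundary_slope_le[OF pf d(1), where K = 0])
      fix t assume t: "0 < t" "t < d"
      have "(p + t *\<^sub>R e) - x0 = (t - d) *\<^sub>R e" by (simp add: x0_def algebra_simps)
      then have dst: "dist (p + t *\<^sub>R e) x0 = d - t" using t e by (simp add: dist_norm)
      then have inb: "p + t *\<^sub>R e \<in> ball x0 d" using t by (simp add: dist_commute)
      then show "p + t *\<^sub>R e \<in> S" using sub by blast
      have "z x0 * t \<le> z (p + t *\<^sub>R e) * (2 * d - t)"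
        using Harnack_affine(1)[OF d(1) sub z0[unfolded z_def, OF less_imp_le[OF above]] inb]
        by (simp add: dst z_def)
      also have "\<dots> \<le> z (p + t *\<^sub>R e) * (2 * d)"
        using t z0[OF less_imp_le[OF above[OF inb]]] by (intro mult_left_mono) auto
      finally have "z x0 * t / (2 * d) \<le> z (p + t *\<^sub>R e)"
        using d by (simp add: pos_divide_le_eq)
      moreover have "z (p + t *\<^sub>R e) = t + \<sigma> * (u (p + t *\<^sub>R e) - u p)"
        using \<sigma>(2) p by (simp add: z_def \<sigma>_def[symmetric] inner_add_right inner_commute[of e p] ee right_diff_distrib)
      ultimately show "(- \<sigma>) * (u (p + t *\<^sub>R e) - u p) \<le> (1 - z x0 / (2 * d)) * t + 0 * t\<^sup>2"
        by (simp add: algebra_simps)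
    qed
    then have "z x0 / (2 * d) \<le> 0" using Ge by simp
    then have "z x0 \<le> 0" using d by (simp add: divide_le_0_iff)
    moreover have "x0 \<bullet> e = \<beta> + d" by (simp add: x0_def inner_add_left p ee)
    ultimately have "x0 \<in> Z" using z0[of x0] d by (auto simp: Z_def T_def)
    then show ?thesis by blast
  qed
  moreover have "openin (top_of_set T) Z"
  proof -
    have "\<exists>d>0. ball x d \<subseteq> Z" if x: "x \<in> Z" for x
    proof -
      have "x \<in> S \<inter> T" using ZS[OF x] x by (auto simp: Z_def)
      then obtain d0 where d0: "d0 > 0" "ball x d0 \<subseteq> S \<inter> T"
        using openE[OF open_Int[OF open_S T(1)]] by blast
      define d where "d = d0 / 2"
      have d: "d > 0" using d0(1) by (simp add: d_def)
      have "y \<in> Z" if y: "y \<in> ball x d" for y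
      proof -
        have sub: "ball y d \<subseteq> S \<inter> T"
        proof (rule order_trans[OF _ d0(2)], rule subsetI)
          fix w assume "w \<in> ball y d"
          then show "w \<in> ball x d0" using y dist_triangle[of x w y] by (simp add: d_def)
        qed
        have subS: "ball y d \<subseteq> S" using sub by blast
        have posz: "(- \<beta> - 1) + e \<bullet> w + \<sigma> * u w \<ge> 0" if "w \<in> ball y d" for w
          using z0[of w] sub that by (auto simp: T_def z_def)
        have xy: "x \<in> ball y d" using y by (simp add: dist_commute)
        have "z y * (d - dist x y) \<le> z x * (d + dist x y)"
          using Harnack_affine(1)[OF d subS posz xy] by (simp add: z_def)
        also have "z x = 0" using x by (simp add: Z_def)
        finally have "z y \<le> 0" using y by (simp add: mult_le_0_iff)
        moreover have "y \<in> T" using sub d by auto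
        ultimately show ?thesis using z0[of y] by (auto simp: Z_def T_def)
      qed
      then show ?thesis using d by blast
    qed
    then have "open Z" by (simp add: open_contains_ball)
    then show ?thesis by (intro open_subset) (auto simp: Z_def)
  qed
  moreover have "closedin (top_of_set T) Z"
  proof -
    have "continuous_on T z" unfolding z_def[abs_def] by (intro continuous_intros)
    then have "closedin (top_of_set T) (T \<inter> z -` {0})"
      by (intro continuous_closedin_preimage) auto
    moreover have "T \<inter> z -` {0} = Z" by (auto simp: Z_def)
    ultimately show ?thesis by simp
  qed
  ultimately have ZT: "Z = T" using T(2) unfolding connected_clopen by blast
  have inner: "u y = \<sigma> * (1 - (y \<bullet> e - \<beta>))" if "y \<in> T" for y
  proof -
    have "z y = 0" using that ZT by (auto simp: Z_def)
    then have "\<sigma> * u y = 1 - (y \<bullet> e - \<beta>)"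
      by (simp add: z_def inner_commute[of e] algebra_simps)
    then have "\<sigma> * (\<sigma> * u y) = \<sigma> * (1 - (y \<bullet> e - \<beta>))" by simp
    then show ?thesis using \<sigma>(2) by (simp add: mult.assoc[symmetric])
  qed
  consider "x \<bullet> e = \<beta>" | "x \<in> T" | "x \<bullet> e = \<beta> + 2" using x by (force simp: T_def)
  then show ?thesis
  proof cases
    case 1
    then show ?thesis using constant_on_line[OF line _ p] by simp
  next
    case 2
    then show ?thesis using inner by (simp add: \<sigma>_def)
  next
    case 3
    \<comment> \<open>the far edge of the strip, by continuity\<close>
    have "\<bar>u x + \<sigma>\<bar> \<le> 0"
    proof (rule field_le_epsilon)
      fix \<epsilon> :: real assume \<epsilon>: "\<epsilon> > 0"
      define t where "t = min \<epsilon> 1 / 2"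
      have t: "t > 0" "t < 2" "2 * t \<le> \<epsilon>" using \<epsilon> by (auto simp: t_def)
      have xt: "(x - t *\<^sub>R e) \<bullet> e = \<beta> + 2 - t" by (simp add: inner_diff_left 3 ee)
      then have "x - t *\<^sub>R e \<in> T" using t unfolding T_def mem_Collect_eq by linarith
      from inner[OF this] have "u (x - t *\<^sub>R e) = \<sigma> * (t - 1)"
        unfolding xt by (simp add: algebra_simps)
      moreover have "dist x (x - t *\<^sub>R e) = t" using t e by (simp add: dist_norm)
      ultimately have "\<bar>u x - \<sigma> * (t - 1)\<bar> \<le> t" using lipschitz[of x "x - t *\<^sub>R e"] by simp
      then have "\<bar>u x + \<sigma>\<bar> \<le> 2 * t" using \<sigma>(1) by (auto simp: abs_le_iff)
      then show "\<bar>u x + \<sigma>\<bar> \<le> 0 + \<epsilon>" using t by simp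
    qed
    then show ?thesis using 3 by (simp add: \<sigma>_def)
  qed
qed

definition constant_on_lines :: "real^2 \<Rightarrow> real \<Rightarrow> real \<Rightarrow> bool"
  where "constant_on_lines e a b \<longleftrightarrow>
    (\<forall>x y. a \<le> x \<bullet> e \<and> x \<bullet> e \<le> b \<and> x \<bullet> e = y \<bullet> e \<longrightarrow> u x = u y)"

text \<open>
  The component \<open>C\<close> that contains the line is a union of parallel lines, whose heights form a closed
  interval. If it ends at a height \<open>\<beta> < a + 2\<close>, then \<open>S\<close> lies directly beyond that edge by local
  convexity, and \<open>u\<close> is linear up to the height \<open>\<beta> + 2\<close>, where it takes the opposite boundary value.
\<close>

lemma advance_to_next_line:
  assumes e: "norm e = 1" and line: "{x. x \<bullet> e = a} \<inter> S = {}"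
  obtains a' where "a' \<ge> a + 2" "{x. x \<bullet> e = a'} \<inter> S = {}"
    "constant_on_lines e a a'"
proof -
  have ee: "e \<bullet> e = 1" using e by (simp add: norm_eq_1)
  define C where "C = connected_component_set (- S) (a *\<^sub>R e)"
  have "(a *\<^sub>R e) \<bullet> e = a" by (simp add: ee)
  then have ae: "a *\<^sub>R e \<in> - S" using line by blast
  then have C: "C \<in> components (- S)" by (simp add: C_def componentsI)
  have La: "{x. x \<bullet> e = a} \<subseteq> C"
    unfolding C_def by (rule connected_component_maximal) (use line ee connected_line in auto)
  note cc = component_closed_convex[OF C]
  have par: "{x. x \<bullet> e = c \<bullet> e} \<subseteq> C" if "c \<in> C" for c
    by (rule convex_contains_parallel_line[OF cc e La that])
  have CS: "C \<inter> S = {}" using in_components_subset[OF C] by blast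
  define J where "J = {t. t *\<^sub>R e \<in> C}"
  have J_iff: "x \<bullet> e \<in> J \<longleftrightarrow> x \<in> C" for x
  proof -
    define w where "w = (x \<bullet> e) *\<^sub>R e"
    have w: "w \<bullet> e = x \<bullet> e" by (simp add: w_def ee)
    have "x \<bullet> e \<in> J \<longleftrightarrow> w \<in> C" by (simp add: J_def w_def)
    moreover have "x \<in> C" if "w \<in> C" using subsetD[OF par[OF that], of x] w by simp
    moreover have "w \<in> C" if "x \<in> C" using subsetD[OF par[OF that], of w] w by simp
    ultimately show ?thesis by blast
  qed
  have aJ: "a \<in> J" using subsetD[OF La, of "a *\<^sub>R e"] by (simp add: J_def ee)
  have Jc: "closed J"
  proof -
    have "closed ((\<lambda>t. t *\<^sub>R e) -` C)" by (intro closed_vimage cc continuous_intros)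
    then show ?thesis by (simp add: J_def vimage_def)
  qed
  have Jconv: "s \<in> J" if "t \<in> J" "a \<le> s" "s \<le> t" for s t
  proof (cases "t = a")
    case True then show ?thesis using that aJ by simp
  next
    case False
    then have "a < t" using that by simp
    define l where "l = (s - a) / (t - a)"
    have l: "0 \<le> l" "l \<le> 1" "l * (t - a) = s - a" using that \<open>a < t\<close> by (auto simp: l_def)
    have "(1 - l) *\<^sub>R (a *\<^sub>R e) + l *\<^sub>R (t *\<^sub>R e) \<in> C"
      using aJ that l by (intro convexD_alt[OF cc(2)]) (auto simp: J_def)
    moreover have "(1 - l) *\<^sub>R (a *\<^sub>R e) + l *\<^sub>R (t *\<^sub>R e) = (a + l * (t - a)) *\<^sub>R e"
      by (simp add: algebra_simps)
    ultimately show ?thesis using l by (simp add: J_def)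
  qed
  have const: "u x = u y" if "x \<bullet> e \<in> J" "x \<bullet> e = y \<bullet> e" for x y
  proof (rule constant_on_line)
    show "{w. w \<bullet> e = x \<bullet> e} \<inter> S = {}" using par[of x] that(1) CS by (auto simp: J_iff)
  qed (use that in auto)
  show ?thesis
  proof (cases "a + 2 \<in> J")
    case True
    show ?thesis
    proof (rule that[of "a + 2"])
      show "{x. x \<bullet> e = a + 2} \<inter> S = {}" using True J_iff CS by force
      show "constant_on_lines e a (a + 2)"
        unfolding constant_on_lines_def using const Jconv[OF True] by blast
    qed simp
  next
    case False
    have "compact (J \<inter> {a..a+2})" using Jc by (intro closed_Int_compact) auto
    moreover have "a \<in> J \<inter> {a..a+2}" using aJ by simp
    ultimately obtain \<beta> where "\<beta> \<in> J \<inter> {a..a+2}"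
      and \<beta>max: "\<And>t. t \<in> J \<inter> {a..a+2} \<Longrightarrow> t \<le> \<beta>"
      using compact_attains_sup[of "J \<inter> {a..a+2}"] by blast
    then have \<beta>: "\<beta> \<in> J" "a \<le> \<beta>" "\<beta> \<le> a + 2" by auto
    have above: "t \<notin> J" if "t > \<beta>" for t
    proof
      assume t: "t \<in> J"
      have "t < a + 2" using Jconv[OF t, of "a + 2"] False by force
      then show False using \<beta>max[of t] t that \<beta> by auto
    qed
    define p where "p = \<beta> *\<^sub>R e"
    have pe: "p \<bullet> e = \<beta>" by (simp add: p_def ee)
    have pC: "p \<in> C" using \<beta>(1) by (simp add: J_def p_def)
    have L: "{x. x \<bullet> e = \<beta>} \<inter> S = {}" using par[OF pC] CS pe by auto
    have "p \<notin> S" using pC CS by blast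
    then obtain r where r: "r > 0" "convex (- S \<inter> ball p r)"
      using complement_locally_convex by blast
    have side: "x \<in> S" if "x \<in> ball p r" "x \<bullet> e > \<beta>" for x
      using component_absorbs[OF C pC r] above[OF that(2)] that(1) J_iff[of x] by blast
    note lin = linear_beyond_flat_boundary[OF e L pe r(1) side]
    show ?thesis
    proof (rule that[of "\<beta> + 2"])
      have "u x \<notin> {-1<..<1}" if "x \<bullet> e = \<beta> + 2" for x
        using lin[of x] that outside[OF \<open>p \<notin> S\<close>] by auto
      then show "{x. x \<bullet> e = \<beta> + 2} \<inter> S = {}" by (force simp: S_eq)
      have "u x = u y" if "a \<le> x \<bullet> e" "x \<bullet> e \<le> \<beta> + 2" "x \<bullet> e = y \<bullet> e" for x y
      proof (cases "x \<bullet> e \<le> \<beta>")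
        case True
        then show ?thesis using const that Jconv[OF \<beta>(1)] by blast
      next
        case False
        then show ?thesis using lin[of x] lin[of y] that by simp
      qed
      then show "constant_on_lines e a (\<beta> + 2)" unfolding constant_on_lines_def by blast
    qed (use \<beta> in simp)
  qed
qed

lemma constant_on_lines_above:
  assumes e: "norm e = 1" and line: "{x. x \<bullet> e = a} \<inter> S = {}"
    and xy: "a \<le> x \<bullet> e" "x \<bullet> e = y \<bullet> e"
  shows "u x = u y"
proof -
  have "\<exists>a'\<ge>a + 2 * real n. {x. x \<bullet> e = a'} \<inter> S = {} \<and> constant_on_lines e a a'" for n
  proof (induction n)
    case 0
    show ?case
      by (intro exI[of _ a]) (use line constant_on_line[OF line] in \<open>auto simp: constant_on_lines_def\<close>)
  next
    case (Suc n)
    from Suc.IH obtain a' where a': "a' \<ge> a + 2 * real n" "{x. x \<bullet> e = a'} \<inter> S = {}"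
      "constant_on_lines e a a'" by blast
    obtain a'' where a'': "a'' \<ge> a' + 2" "{x. x \<bullet> e = a''} \<inter> S = {}"
      "constant_on_lines e a' a''"
      using advance_to_next_line[OF e a'(2)] .
    have "constant_on_lines e a a''"
      using a'(3) a''(3) unfolding constant_on_lines_def by (meson linear)
    then show ?case using a' a'' by (intro exI[of _ a'']) auto
  qed
  moreover obtain n where n: "x \<bullet> e - a < real n" using reals_Archimedean2 by blast
  ultimately obtain a' where a': "a' \<ge> a + 2 * real n" "constant_on_lines e a a'" by blast
  have "x \<bullet> e \<le> a'" using n a'(1) xy(1) by linarith
  then show ?thesis using a'(2) xy unfolding constant_on_lines_def by blast
qed

text \<open>
  A separating closed set in the plane has a separating component; it contains a line, from which
  the plane is covered in the two directions \<open>e\<close> and \<open>- e\<close>.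
\<close>

lemma one_dimensional_if_disconnected:
  assumes "\<not> connected S"
  shows "one_dimensional u"
proof -
  obtain C where C: "C \<in> components (- S)" "\<not> connected (- C)"
    using separation_by_component_closed[of "- S"] open_S assms by auto
  obtain e a where e: "norm e = 1" and line: "{x. x \<bullet> e = a} \<subseteq> C"
    using convex_separator_contains_line[OF component_closed_convex[OF C(1)] C(2)] .
  have L: "{x. x \<bullet> e = a} \<inter> S = {}" using line in_components_subset[OF C(1)] by blast
  have e': "norm (- e) = 1" and L': "{x. x \<bullet> (- e) = - a} \<inter> S = {}" using e L by auto
  have ee: "e \<bullet> e = 1" using e by (simp add: norm_eq_1)
  have "u x = u ((x \<bullet> e) *\<^sub>R e)" for x
  proof (cases "a \<le> x \<bullet> e")
    case True
    show ?thesis by (rule constant_on_lines_above[OF e L True]) (simp add: ee)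
  next
    case False
    show ?thesis by (rule constant_on_lines_above[OF e' L']) (use False in \<open>simp_all add: ee\<close>)
  qed
  then show ?thesis
    unfolding one_dimensional_def using e by (intro exI[of _ e] conjI exI[of _ "\<lambda>t. u (t *\<^sub>R e)"]) auto
qed

end

text \<open>
  The continuous extensions of the partial derivatives to the closure of \<open>S\<close> combine to a vector
  field, and its boundary values are the limits that define the boundary gradient.
\<close>

lemma classical_solution_extended_gradient:
  assumes sol: "classical_solution u" and ne: "middle_phase u \<noteq> {}" "middle_phase u \<noteq> UNIV"
  obtains G where "free_boundary_solution (middle_phase u) u G"
proof -
  define S where "S = middle_phase u"
  have op: "open S" and sm: "smooth_boundary S" and cu: "continuous_on UNIV u" and C2: "C2_on_closure S u"
    and lap: "\<And>x. x \<in> S \<Longrightarrow> laplacian u x = 0" and out: "\<And>x. x \<notin> S \<Longrightarrow> u x = 1 \<or> u x = -1"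
    and bg: "\<And>x. x \<in> frontier S \<Longrightarrow> norm (boundary_grad S u x) = 1"
    using sol unfolding classical_solution_def S_def Let_def by blast+
  have d1: "\<And>x. x \<in> S \<Longrightarrow> u differentiable at x"
    and d2: "\<And>i x. i \<in> Basis \<Longrightarrow> x \<in> S \<Longrightarrow> partial_deriv i u differentiable at x"
    and ext: "\<forall>i\<in>Basis. \<exists>g. continuous_on (closure S) g \<and> (\<forall>x\<in>S. g x = partial_deriv i u x)"
    using C2 unfolding C2_on_closure_def by blast+
  obtain g where g: "\<And>i. i \<in> Basis \<Longrightarrow> continuous_on (closure S) (g i)"
    "\<And>i x. i \<in> Basis \<Longrightarrow> x \<in> S \<Longrightarrow> g i x = partial_deriv i u x"
    using bchoice[OF ext] by blast
  define G where "G x = (\<Sum>i\<in>Basis. g i x *\<^sub>R i)" for x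
  have cG: "continuous_on (closure S) G"
    unfolding G_def[abs_def] by (intro continuous_intros g)
  have GS: "G x = grad u x" if "x \<in> S" for x
    unfolding G_def grad_def by (rule sum.cong) (use g(2) that in auto)
  have nG: "norm (G x) = 1" if x: "x \<in> frontier S" for x
  proof -
    have xc: "x \<in> closure S" "x \<notin> S" using x op by (auto simp: frontier_def interior_open)
    then have "x islimpt S" by (auto simp: closure_def)
    then have nb: "at x within S \<noteq> bot" by (simp add: trivial_limit_within)
    have "(G \<longlongrightarrow> G x) (at x within closure S)" using cG xc(1) by (simp add: continuous_on_def)
    then have "(G \<longlongrightarrow> G x) (at x within S)" by (rule tendsto_within_subset) (rule closure_subset)
    moreover have "\<forall>\<^sub>F y in at x within S. G y = grad u y"
      unfolding eventually_at_filter by (rule always_eventually) (use GS in auto)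
    ultimately have "(grad u \<longlongrightarrow> G x) (at x within S)" by (rule Lim_transform_eventually)
    then have "boundary_grad S u x = G x"
      unfolding boundary_grad_def using nb by (intro tendsto_Lim)
    then show ?thesis using bg[OF x] by simp
  qed
  have "free_boundary_solution S u G"
    by unfold_locales
      (use op d1 d2 lap sm cu out cG GS nG ne in \<open>auto simp: S_def middle_phase_def\<close>)
  then show ?thesis using that by (simp add: S_def)
qed

theorem theorem1p3:
  fixes u :: "real^2 \<Rightarrow> real"
  assumes "classical_solution u"
    and "\<not> connected (middle_phase u)"
  shows "one_dimensional u"
proof -
  have "middle_phase u \<noteq> {}" "middle_phase u \<noteq> UNIV"
    using assms(2) by (metis connected_empty, metis connected_UNIV)
  then obtain G where "free_boundary_solution (middle_phase u) u G"
    using classical_solution_extended_gradient[OF assms(1)] by blast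
  then show ?thesis
    using assms(2) by (rule free_boundary_solution.one_dimensional_if_disconnected)
qed

end
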